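(* Let $K$ be a local field of positive characteristic and let $\Psi=\{\psi^1,\psi^2,\dots,\psi^L\}\subset L^2(K)$ be a finite family. Then: (a) The affine system $X(\Psi)$ is a Bessel family if and only if the quasi-affine system $\tilde X(\Psi)$ is a Bessel family. Moreover, in that case their exact upper bounds are equal. (b) $X(\Psi)$ is an affine frame for $L^2(K)$ if and only if $\tilde X(\Psi)$ is a quasi-affine frame for $L^2(K)$. Moreover, in that case their exact lower bounds are equal and their exact upper bounds are equal.
   Context: Local field: a field $K$ with a topology that is locally compact, nondiscrete and totally disconnected; here $K$ has characteristic $p>0$. $dx$ is Haar measure on the additive group $K^+$, and the absolute value is defined by $d(\alpha x)=|\alpha|\,dx$, $|0|=0$; it is ultrametric. $\mathfrak{D}=\{x\in K:|x|\le 1\}$ is the ring of integers, $\mathfrak{P}=\{x\in K:|x|<1\}$ the prime ideal, $\mathfrak{D}^*=\mathfrak{D}\setminus\mathfrak{P}$. $\mathfrak{p}$ is a fixed element of maximal absolute value in $\mathfrak{P}$ (prime element). $\mathfrak{D}/\mathfrak{P}\cong GF(q)$ with $q=p^c$, $c\in\mathbb{N}$; Haar measure is normalized so that $\mathfrak{D}$ has measure $1$; then $|\mathfrak{p}|=q^{-1}$. $\mathbb{N}_0=\mathbb{N}\cup\{0\}$. Translation set: fix $1=\epsilon_0,\epsilon_1,\dots,\epsilon_{c-1}\in\mathfrak{D}^*$ whose $GF(p)$-span is isomorphic to $GF(q)\cong\mathfrak{D}/\mathfrak{P}$ (their classes form a basis of $\mathfrak{D}/\mathfrak{P}$ over $GF(p)$).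 For $0\le n<q$, write $n=a_0+a_1p+\cdots+a_{c-1}p^{c-1}$ with $0\le a_k<p$, and set $u(n)=(a_0+a_1\epsilon_1+\cdots+a_{c-1}\epsilon_{c-1})\mathfrak{p}^{-1}$. For general $n\ge 0$, write $n=b_0+b_1q+\cdots+b_sq^s$ with $0\le b_k<q$, and set $u(n)=u(b_0)+u(b_1)\mathfrak{p}^{-1}+\cdots+u(b_s)\mathfrak{p}^{-s}$. ($\{u(n):n\in\mathbb{N}_0\}$ is a complete list of distinct coset representatives of $\mathfrak{D}$ in $K^+$.) Operators on $L^2(K)$: for $j\in\mathbb{Z}$, $y\in K$, $\delta_jf(x)=q^{j/2}f(\mathfrak{p}^{-j}x)$ and $\tau_yf(x)=f(x-y)$. For $f\in L^2(K)$, $j\in\mathbb{Z}$, $k\in\mathbb{N}_0$, let $f_{j,k}=\delta_j\tau_{u(k)}f$; let $\tilde f_{j,k}=\delta_j\tau_{u(k)}f$ if $j\ge0$, and $\tilde f_{j,k}=q^{j/2}\tau_{u(k)}\delta_jf$ if $j<0$. The affine system generated by $\Psi$ is $X(\Psi)=\{\psi^l_{j,k}:1\le l\le L,\,j\in\mathbb{Z},\,k\in\mathbb{N}_0\}$ and the quasi-affine system is $\tilde X(\Psi)=\{\tilde\psi^l_{j,k}:1\le l\le L,\,j\in\mathbb{Z},\,k\in\mathbb{N}_0\}$, both regarded as families indexed by $(l,j,k)$. $X(\Psi)$ is an (affine) Bessel family if there is $B>0$ with $\sum_{l=1}^L\sum_{j\in\mathbb{Z}}\sum_{k\in\mathbb{N}_0}|\langle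 f,\psi^l_{j,k}\rangle|^2\le B\|f\|_2^2$ for all $f\in L^2(K)$. It is an affine frame if there are $0<A\le B$ with $A\|f\|_2^2\le\sum_{l,j,k}|\langle f,\psi^l_{j,k}\rangle|^2\le B\|f\|_2^2$ for all $f\in L^2(K)$. The exact lower bound is the largest such $A$ (supremum of admissible $A$), and the exact upper bound is the smallest such $B$ (infimum of admissible $B$). The notions of (quasi-affine) Bessel family, quasi-affine frame and exact bounds for $\tilde X(\Psi)$ are the same with $\tilde\psi^l_{j,k}$ in place of $\psi^l_{j,k}$. *)

theory Defs
  imports "HOL-Analysis.Analysis" "HOL-Computational_Algebra.Computational_Algebra"
begin

class local_field = field + t2_space + topological_ab_group_add + topological_semigroup_mult +
  assumes tendsto_inverse_local_field: "a \<noteq> 0 \<Longrightarrow> filterlim inverse (nhds (inverse a)) (nhds a)"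
    and locally_compact_local_field: "\<exists>U C. open U \<and> compact C \<and> x \<in> U \<and> U \<subseteq> C"
    and nondiscrete_local_field: "\<exists>S. \<not> open S"
    and totally_disconnected_local_field: "connected S \<Longrightarrow> \<exists>a. S \<subseteq> {a}"

text \<open>Haar measure on the additive group: a nonzero translation-invariant Radon measure.\<close>

definition additive_haar_measure :: "'k::local_field measure \<Rightarrow> bool" where
  "additive_haar_measure M \<longleftrightarrow>
     sets M = sets borel \<and>
     emeasure M UNIV \<noteq> 0 \<and>
     (\<forall>C. compact C \<longrightarrow> emeasure M C < \<infinity>) \<and>
     (\<forall>S\<in>sets borel. emeasure M S = (INF U\<in>{U. open U \<and> S \<subseteq> U}. emeasure M U)) \<and>
     (\<forall>U. open U \<longrightarrow> emeasure M U = (SUP C\<in>{C. compact C \<and> C \<subseteq> U}. emeasure M C)) \<and>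
     (\<forall>x. \<forall>S\<in>sets borel. emeasure M ((\<lambda>y. x + y) ` S) = emeasure M S)"

text \<open>The absolute value is determined by $d(\alpha x) = |\alpha|\,dx$ and $|0| = 0$.\<close>

definition modulus_of :: "'k::local_field measure \<Rightarrow> ('k \<Rightarrow> real) \<Rightarrow> bool" where
  "modulus_of M v \<longleftrightarrow>
     v 0 = 0 \<and>
     (\<forall>a. a \<noteq> 0 \<longrightarrow> 0 \<le> v a \<and>
        (\<forall>S\<in>sets borel. emeasure M ((\<lambda>x. a * x) ` S) = ennreal (v a) * emeasure M S))"

definition integer_ring :: "('k::local_field \<Rightarrow> real) \<Rightarrow> 'k set" where
  "integer_ring v = {x. v x \<le> 1}"

definition prime_ideal :: "('k::local_field \<Rightarrow> real) \<Rightarrow> 'k set" where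
  "prime_ideal v = {x. v x < 1}"

definition prime_element :: "('k::local_field \<Rightarrow> real) \<Rightarrow> 'k \<Rightarrow> bool" where
  "prime_element v \<pi> \<longleftrightarrow> \<pi> \<in> prime_ideal v \<and> (\<forall>x\<in>prime_ideal v. v x \<le> v \<pi>)"

definition residue_classes :: "('k::local_field \<Rightarrow> real) \<Rightarrow> 'k set set" where
  "residue_classes v = integer_ring v //
     {(x, y). x \<in> integer_ring v \<and> y \<in> integer_ring v \<and> x - y \<in> prime_ideal v}"

text \<open>The classes of $\epsilon_0 = 1, \dots, \epsilon_{c-1}$ form a basis of the residue field over
  its prime field; the prime field is represented by the integers $0, \dots, p - 1$.\<close>

definition residue_basis :: "('k::local_field \<Rightarrow> real) \<Rightarrow> nat \<Rightarrow> nat \<Rightarrow> (nat \<Rightarrow> 'k) \<Rightarrow> bool" where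
  "residue_basis v p c \<epsilon> \<longleftrightarrow>
     \<epsilon> 0 = 1 \<and>
     (\<forall>i<c. \<epsilon> i \<in> integer_ring v - prime_ideal v) \<and>
     (\<forall>a. (\<forall>i<c. a i < p) \<and> (\<Sum>i<c. of_nat (a i) * \<epsilon> i) \<in> prime_ideal v \<longrightarrow> (\<forall>i<c. a i = 0)) \<and>
     (\<forall>x\<in>integer_ring v. \<exists>a. (\<forall>i<c. a i < p) \<and> x - (\<Sum>i<c. of_nat (a i) * \<epsilon> i) \<in> prime_ideal v)"

definition u_digit :: "nat \<Rightarrow> nat \<Rightarrow> 'k::local_field \<Rightarrow> (nat \<Rightarrow> 'k) \<Rightarrow> nat \<Rightarrow> 'k" where
  "u_digit p c \<pi> \<epsilon> n = (\<Sum>i<c. of_nat (n div p ^ i mod p) * \<epsilon> i) * inverse \<pi>"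

text \<open>The summands with $q^k > n$ vanish because \<open>u_digit\<close> is $0$ at $0$, so summing up to $n$
  covers exactly the base-$q$ digits of $n$.\<close>

definition u :: "nat \<Rightarrow> nat \<Rightarrow> 'k::local_field \<Rightarrow> (nat \<Rightarrow> 'k) \<Rightarrow> nat \<Rightarrow> 'k" where
  "u p c \<pi> \<epsilon> n =
     (\<Sum>k\<le>n. u_digit p c \<pi> \<epsilon> (n div (p ^ c) ^ k mod p ^ c) * inverse \<pi> ^ k)"

definition L2 :: "'k::topological_space measure \<Rightarrow> ('k \<Rightarrow> complex) set" where
  "L2 M = {f \<in> borel_measurable M. integrable M (\<lambda>x. (cmod (f x))\<^sup>2)}"

definition inner_L2 :: "'k measure \<Rightarrow> ('k \<Rightarrow> complex) \<Rightarrow> ('k \<Rightarrow> complex) \<Rightarrow> complex" where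
  "inner_L2 M f g = (LINT x|M. f x * cnj (g x))"

definition norm_L2 :: "'k measure \<Rightarrow> ('k \<Rightarrow> complex) \<Rightarrow> real" where
  "norm_L2 M f = sqrt (LINT x|M. (cmod (f x))\<^sup>2)"

definition dilate :: "nat \<Rightarrow> 'k::local_field \<Rightarrow> int \<Rightarrow> ('k \<Rightarrow> complex) \<Rightarrow> 'k \<Rightarrow> complex" where
  "dilate q \<pi> j f = (\<lambda>x. of_real (real q powr (real_of_int j / 2)) * f (\<pi> powi (- j) * x))"

definition translate :: "'k::local_field \<Rightarrow> ('k \<Rightarrow> complex) \<Rightarrow> 'k \<Rightarrow> complex" where
  "translate y f = (\<lambda>x. f (x - y))"

definition affine_system ::
  "nat \<Rightarrow> nat \<Rightarrow> 'k::local_field \<Rightarrow> (nat \<Rightarrow> 'k) \<Rightarrow> (nat \<Rightarrow> 'k \<Rightarrow> complex) \<Rightarrow>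
     nat \<times> int \<times> nat \<Rightarrow> 'k \<Rightarrow> complex" where
  "affine_system p c \<pi> \<epsilon> \<psi> =
     (\<lambda>(l, j, k). dilate (p ^ c) \<pi> j (translate (u p c \<pi> \<epsilon> k) (\<psi> l)))"

definition quasi_affine_system ::
  "nat \<Rightarrow> nat \<Rightarrow> 'k::local_field \<Rightarrow> (nat \<Rightarrow> 'k) \<Rightarrow> (nat \<Rightarrow> 'k \<Rightarrow> complex) \<Rightarrow>
     nat \<times> int \<times> nat \<Rightarrow> 'k \<Rightarrow> complex" where
  "quasi_affine_system p c \<pi> \<epsilon> \<psi> =
     (\<lambda>(l, j, k). if 0 \<le> j then dilate (p ^ c) \<pi> j (translate (u p c \<pi> \<epsilon> k) (\<psi> l))
        else (\<lambda>x. of_real (real (p ^ c) powr (real_of_int j / 2)) *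
                translate (u p c \<pi> \<epsilon> k) (dilate (p ^ c) \<pi> j (\<psi> l)) x))"

text \<open>Coefficient sums are taken in the extended nonnegative reals, where every family has a sum;
  an upper bound thus includes convergence.\<close>

definition coeff_sum ::
  "'k measure \<Rightarrow> 'i set \<Rightarrow> ('i \<Rightarrow> 'k \<Rightarrow> complex) \<Rightarrow> ('k \<Rightarrow> complex) \<Rightarrow> ennreal" where
  "coeff_sum M I e f = (\<Sum>\<^sub>\<infinity>i\<in>I. ennreal ((cmod (inner_L2 M f (e i)))\<^sup>2))"

definition upper_bound ::
  "'k::topological_space measure \<Rightarrow> 'i set \<Rightarrow> ('i \<Rightarrow> 'k \<Rightarrow> complex) \<Rightarrow> real \<Rightarrow> bool" where
  "upper_bound M I e B \<longleftrightarrow> (\<forall>f\<in>L2 M. coeff_sum M I e f \<le> ennreal (B * (norm_L2 M f)\<^sup>2))"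

definition lower_bound ::
  "'k::topological_space measure \<Rightarrow> 'i set \<Rightarrow> ('i \<Rightarrow> 'k \<Rightarrow> complex) \<Rightarrow> real \<Rightarrow> bool" where
  "lower_bound M I e A \<longleftrightarrow> (\<forall>f\<in>L2 M. ennreal (A * (norm_L2 M f)\<^sup>2) \<le> coeff_sum M I e f)"

definition bessel_family ::
  "'k::topological_space measure \<Rightarrow> 'i set \<Rightarrow> ('i \<Rightarrow> 'k \<Rightarrow> complex) \<Rightarrow> bool" where
  "bessel_family M I e \<longleftrightarrow> (\<exists>B>0. upper_bound M I e B)"

definition frame ::
  "'k::topological_space measure \<Rightarrow> 'i set \<Rightarrow> ('i \<Rightarrow> 'k \<Rightarrow> complex) \<Rightarrow> bool" where
  "frame M I e \<longleftrightarrow> (\<exists>A B. 0 < A \<and> A \<le> B \<and> lower_bound M I e A \<and> upper_bound M I e B)"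

text \<open>The real-valued \<open>Inf\<close> and \<open>Sup\<close> below are meaningful for Bessel families and for frames,
  respectively.\<close>

definition exact_upper_bound ::
  "'k::topological_space measure \<Rightarrow> 'i set \<Rightarrow> ('i \<Rightarrow> 'k \<Rightarrow> complex) \<Rightarrow> real" where
  "exact_upper_bound M I e = Inf {B. 0 < B \<and> upper_bound M I e B}"

definition exact_lower_bound ::
  "'k::topological_space measure \<Rightarrow> 'i set \<Rightarrow> ('i \<Rightarrow> 'k \<Rightarrow> complex) \<Rightarrow> real" where
  "exact_lower_bound M I e = Sup {A. 0 < A \<and> lower_bound M I e A}"

end

theory Submission
  imports Defs
begin

text \<open>
  Write \<open>\<Lambda>\<close> for the set of all \<open>u n\<close>; in characteristic \<open>p\<close> it is a subgroup of \<open>K\<close> that meets the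
  integer ring only in \<open>0\<close>, and \<open>\<pi> powi (- J) * \<Lambda>\<close> is a subgroup of \<open>\<Lambda>\<close> with coset
  representatives \<open>u n\<close>, \<open>n < q ^ J\<close>. Averaging the affine coefficient sum of level \<open>j\<close> over the
  translates of \<open>f\<close> by these representatives gives the quasi-affine sum of level \<open>j\<close>, for every
  \<open>j \<ge> - J\<close>; conversely the affine sum of \<open>f\<close> over \<open>j \<ge> - J\<close> is the one of its dilate by \<open>J\<close>
  over \<open>j \<ge> 0\<close>, where both systems agree. Letting \<open>J\<close> tend to infinity, both systems have the same
  upper bounds. For lower bounds the levels \<open>j < - J\<close> must be negligible. For \<open>f\<close> supported in a disc
  and translates by large lattice points they are controlled by how rarely the dilated supports
  overlap modulo \<open>\<Lambda>\<close>; the remaining translates form a proportion \<open>q ^ (- k)\<close> of all and are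
  controlled by the upper bound. General \<open>f\<close> follow by truncation.

  The modulus is ultrametric because local compactness gives \<open>v (x + y) \<le> R * max (v x) (v y)\<close>
  for some \<open>R\<close>, and applying this to \<open>p ^ n\<close>-th powers improves \<open>R\<close> to \<open>1\<close>.
\<close>

section \<open>The modulus of a local field\<close>

text \<open>The affine sum is invariant under dilations, the quasi-affine sum under lattice
  translations; so a bound is moved from one system to the other by dilating \<open>f\<close> or by
  averaging over translates. Upper bounds survive the loss of levels, lower bounds do not, and this
  is the obstacle. The coarse levels become negligible for different reasons in the two directions.
  A quasi-affine level \<open>j < 0\<close> carries the weight \<open>q powi j\<close>, so these
  levels have a common integrable majorant; dilating \<open>f\<close> into ever smaller discs makes
  the lattice overlap vanish almost everywhere, and dominated convergence applies. The affine levels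
  carry no such weight. There the average over many translates is made small instead, by counting
  how many pairs of a translate and a level can meet a fixed point. The modulus is known only
  through Haar measure. Its relation to the topology is extracted from regularity: for
  \<open>w\<close> near \<open>a\<close>, the set \<open>w * C\<close> lies in any given open set
  around \<open>a * C\<close>.\<close>

lemma open_nhd_mult_compact:
  fixes a :: "'k::local_field"
  assumes "compact C" "open O'" "\<And>x. x \<in> C \<Longrightarrow> a * x \<in> O'"
  obtains W where "open W" "a \<in> W" "\<And>w x. w \<in> W \<Longrightarrow> x \<in> C \<Longrightarrow> w * x \<in> O'"
proof -
  let ?m = "\<lambda>z::'k \<times> 'k. fst z * snd z"
  have "continuous_on UNIV ?m" by (intro continuous_intros)
  then have 1: "open (?m -` O')" using assms(2) by (simp add: open_vimage)
  have 2: "{a} \<times> C \<subseteq> ?m -` O'" using assms(3) by auto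
  obtain W where "a \<in> W" "open W" "W \<times> C \<subseteq> ?m -` O'"
    using Elementary_Topology.tube_lemma[OF assms(1) 1 2] by blast
  then show ?thesis using that[of W] by (auto simp: subset_iff)
qed

lemma continuous_on_affine_map: "continuous_on S (\<lambda>x. a * x + b :: 'k::local_field)"
  by (intro continuous_intros)

lemma mult_image_eq_vimage:
  fixes a :: "'k::local_field"
  assumes "a \<noteq> 0"
  shows "(*) a ` S = (\<lambda>x. inverse a * x + 0) -` S"
proof (intro set_eqI iffI)
  fix x assume "x \<in> (*) a ` S"
  then obtain s where "s \<in> S" "x = a * s" by blast
  then show "x \<in> (\<lambda>x. inverse a * x + 0) -` S" using assms by (simp flip: mult.assoc)
next
  fix x assume "x \<in> (\<lambda>x. inverse a * x + 0) -` S"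
  then have "inverse a * x \<in> S" by simp
  moreover have "x = a * (inverse a * x)" using assms by (simp flip: mult.assoc)
  ultimately show "x \<in> (*) a ` S" by (rule rev_image_eqI)
qed

lemma open_mult_image:
  fixes a :: "'k::local_field"
  assumes "a \<noteq> 0" "open S" shows "open ((*) a ` S)"
proof -
  have "(*) a ` S = (\<lambda>x. inverse a * x + 0) -` S"
    by (rule mult_image_eq_vimage[OF assms(1)])
  then show ?thesis using open_vimage[OF assms(2) continuous_on_affine_map[of UNIV "inverse a" 0]] by simp
qed

lemma compact_mult_image: "compact S \<Longrightarrow> compact ((*) (a::'k::local_field) ` S)"
  using compact_continuous_image[OF continuous_on_affine_map[of S a 0]] by (simp add: image_def)

lemma translation_image_eq_vimage:
  fixes a :: "'k::local_field"
  shows "(+) a ` S = (\<lambda>x. 1 * x + (-a)) -` S"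
proof (intro set_eqI iffI)
  fix x assume "x \<in> (\<lambda>x. 1 * x + (-a)) -` S"
  then have "x - a \<in> S" by simp
  then show "x \<in> (+) a ` S" by (rule rev_image_eqI) simp
qed auto

lemma open_translation_image:
  fixes a :: "'k::local_field"
  assumes "open S" shows "open ((+) a ` S)"
  unfolding translation_image_eq_vimage using open_vimage[OF assms continuous_on_affine_map] .

lemma compact_plus:
  fixes S T :: "'k::local_field set"
  assumes "compact S" "compact T" shows "compact {x + y |x y. x \<in> S \<and> y \<in> T}"
proof -
  have "{x + y |x y. x \<in> S \<and> y \<in> T} = (\<lambda>z. fst z + snd z) ` (S \<times> T)" by force
  moreover have "continuous_on (S \<times> T) (\<lambda>z. fst z + snd z)" by (intro continuous_intros)
  ultimately show ?thesis using compact_continuous_image[OF _ compact_Times[OF assms]] by simp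
qed

lemma infinite_local_field: "infinite (UNIV :: 'k::local_field set)"
proof
  assume fin: "finite (UNIV :: 'k set)"
  have "open (S :: 'k set)" for S
  proof -
    have "closed (-S)" by (rule finite_imp_closed) (rule finite_subset[OF _ fin], simp)
    then show "open S" by (simp add: closed_def)
  qed
  then show False using nondiscrete_local_field by blast
qed

text \<open>If one point were open, translation would make every set open. This supplies nonzero
  points in each neighbourhood of 0.\<close>

lemma not_open_singleton: "\<not> open {0 :: 'k::local_field}"
proof
  assume o: "open {0 :: 'k}"
  have "open (S :: 'k set)" for S
  proof -
    have "open (\<Union>x\<in>S. (+) x ` {0})" using o open_translation_image by blast
    then show ?thesis by simp
  qed
  then show False using nondiscrete_local_field by blast
qed

locale normalized_local_field =
  fixes M :: "'k::local_field measure"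
    and v :: "'k \<Rightarrow> real"
    and p c :: nat
    and \<pi> :: 'k
    and \<epsilon> :: "nat \<Rightarrow> 'k"
  assumes char_p: "CHAR('k) = p" and p_pos: "p > 0"
    and haar: "additive_haar_measure M"
    and modulus: "modulus_of M v"
    and integer_ring_measure: "emeasure M (integer_ring v) = 1"
    and prime_elem: "prime_element v \<pi>"
    and c_pos: "c \<ge> 1"
    and basis: "residue_basis v p c \<epsilon>"
begin

abbreviation "\<O> \<equiv> integer_ring v"

lemma sets_M [measurable_cong, simp]: "sets M = sets borel"
  using haar by (simp add: additive_haar_measure_def)

lemma space_M [simp]: "space M = UNIV"
  using sets_eq_imp_space_eq[OF sets_M] by simp

lemma outer_regular: "S \<in> sets borel \<Longrightarrow> emeasure M S = (INF U\<in>{U. open U \<and> S \<subseteq> U}. emeasure M U)"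
  and inner_regular: "open S \<Longrightarrow> emeasure M S = (SUP C\<in>{C. compact C \<and> C \<subseteq> S}. emeasure M C)"
  and emeasure_UNIV_nonzero: "emeasure M UNIV \<noteq> 0"
  using haar unfolding additive_haar_measure_def by blast+

lemma emeasure_translation: "S \<in> sets borel \<Longrightarrow> emeasure M ((+) x ` S) = emeasure M S"
  using haar by (simp add: additive_haar_measure_def)

lemma compact_finite_measure: "compact C \<Longrightarrow> emeasure M C < \<infinity>"
  using haar by (simp add: additive_haar_measure_def)

lemma emeasure_mult: "a \<noteq> 0 \<Longrightarrow> S \<in> sets borel \<Longrightarrow> emeasure M ((*) a ` S) = ennreal (v a) * emeasure M S"
  using modulus by (simp add: modulus_of_def)

lemma borel_mult_image:
  fixes a :: 'k
  assumes "a \<noteq> 0" "S \<in> sets borel" shows "(*) a ` S \<in> sets borel"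
proof -
  have "(*) a ` S = (\<lambda>x. inverse a * x + 0) -` S"
    by (rule mult_image_eq_vimage[OF assms(1)])
  moreover have "(\<lambda>x. inverse a * x + 0) \<in> borel_measurable borel"
    by (intro borel_measurable_continuous_onI continuous_on_affine_map)
  ultimately show ?thesis using assms(2) by (metis measurable_sets_borel)
qed

text \<open>\<open>emeasure\<close> is 0 off the sigma-algebra, so the normalization to 1 forces
  measurability while nothing is known yet about the topology of the unit disc.\<close>

lemma O_borel [measurable]: "\<O> \<in> sets borel"
  using integer_ring_measure emeasure_notin_sets[of \<O> M] by (metis sets_M zero_neq_one)

lemma v_0 [simp]: "v 0 = 0" and v_nonneg [simp]: "v a \<ge> 0"
  using modulus by (cases "a = 0"; force simp: modulus_of_def)+

lemma v_eq_emeasure: "a \<noteq> 0 \<Longrightarrow> ennreal (v a) = emeasure M ((*) a ` \<O>)"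
  by (simp add: emeasure_mult integer_ring_measure)

lemma v_mult: "v (a * b) = v a * v b"
proof (cases "a = 0 \<or> b = 0")
  case False
  then have "ennreal (v (a * b)) = emeasure M ((*) a ` ((*) b ` \<O>))"
    by (subst v_eq_emeasure) (auto simp: image_image mult.assoc)
  also have "\<dots> = ennreal (v a * v b)"
    using False by (simp add: emeasure_mult borel_mult_image integer_ring_measure ennreal_mult)
  finally show ?thesis by simp
qed auto

lemma v_1 [simp]: "v 1 = 1"
proof -
  have "ennreal (v 1) = 1" by (subst v_eq_emeasure) (auto simp: integer_ring_measure)
  then show ?thesis by simp
qed

lemma v_inverse: "v (inverse a) = inverse (v a)"
proof (cases "a = 0")
  case False
  then have "v a * v (inverse a) = 1" by (simp flip: v_mult)
  then show ?thesis by (metis inverse_unique)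
qed simp

lemma v_eq_0_iff [simp]: "v a = 0 \<longleftrightarrow> a = 0"
proof
  assume "v a = 0"
  then have "a = 0 \<or> v (a * inverse a) = 0" by (simp add: v_mult)
  then show "a = 0" by (cases "a = 0") auto
qed simp

lemma v_pos_iff [simp]: "v a > 0 \<longleftrightarrow> a \<noteq> 0"
  using v_nonneg[of a] v_eq_0_iff[of a] by linarith

lemma v_divide: "v (a / b) = v a / v b"
  by (simp add: divide_inverse v_mult v_inverse)

lemma v_le_0_iff [simp]: "v a \<le> 0 \<longleftrightarrow> a = 0"
  using v_nonneg[of a] v_eq_0_iff[of a] by linarith

lemma v_power: "v (a ^ n) = v a ^ n"
  by (induction n) (auto simp: v_mult)

lemma v_power_int: "v (a powi n) = v a powi n"
  by (auto simp: power_int_def v_power v_inverse)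

lemma v_minus [simp]: "v (- a) = v a"
proof -
  have "v (-1) ^ 2 = 1" by (simp flip: v_power)
  then have "v (-1) = 1" by (metis abs_of_nonneg abs_one real_sqrt_abs v_nonneg real_sqrt_one)
  then show ?thesis using v_mult[of "-1" a] by simp
qed

lemma v_pi_less_1: "v \<pi> < 1"
  using prime_elem by (simp add: prime_element_def prime_ideal_def)

lemma v_le_v_pi: "v x < 1 \<Longrightarrow> v x \<le> v \<pi>"
  using prime_elem by (simp add: prime_element_def prime_ideal_def)

text \<open>If \<open>\<pi> = 0\<close>, maximality leaves no nonzero element with
  \<open>v x < 1\<close> and, by inversion, none with \<open>v x > 1\<close>. Then every element
  equals one of finitely many residue representatives, although the field is infinite.\<close>

lemma pi_nonzero [simp]: "\<pi> \<noteq> 0"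
proof
  assume "\<pi> = 0"
  then have small: "v x < 1 \<Longrightarrow> x = 0" for x using v_le_v_pi[of x] v_nonneg[of x] v_eq_0_iff[of x] by auto
  have unit: "x \<in> \<O>" for x
  proof (rule ccontr)
    assume "x \<notin> \<O>"
    then have "v x > 1" by (simp add: integer_ring_def)
    then have "v (inverse x) < 1" by (simp add: v_inverse inverse_less_1_iff)
    then have "x = 0" using small by fastforce
    then show False using \<open>v x > 1\<close> by simp
  qed
  let ?F = "(\<lambda>a. \<Sum>i<c. of_nat (a i) * \<epsilon> i) ` (PiE {..<c} (\<lambda>_. {..<p}))"
  have "x \<in> ?F" for x
  proof -
    obtain a where a: "\<forall>i<c. a i < p" "v (x - (\<Sum>i<c. of_nat (a i) * \<epsilon> i)) < 1"
      using basis unit[of x] unfolding residue_basis_def prime_ideal_def by blast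
    then have "x = (\<Sum>i<c. of_nat (restrict a {..<c} i) * \<epsilon> i)" using small by force
    moreover have "restrict a {..<c} \<in> PiE {..<c} (\<lambda>_. {..<p})" using a by (auto intro!: restrict_PiE)
    ultimately show ?thesis by (rule image_eqI)
  qed
  then have "(UNIV :: 'k set) = ?F" by blast
  moreover have "finite ?F" by (intro finite_imageI finite_PiE) auto
  ultimately show False using infinite_local_field by metis
qed

section \<open>Measure and topology: local bounds for the modulus, compactness,
  ultrametricity\<close>

lemma singleton_null: "emeasure M {x} = 0"
proof -
  \<comment> \<open>Multiplication by \<pi> fixes \<open>{0}\<close> but scales its finite measure
    by \<open>v \<pi> < 1\<close>.\<close>
  have "emeasure M {0} = ennreal (v \<pi>) * emeasure M {0}"
    using emeasure_mult[of \<pi> "{0}"] by simp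
  moreover have "emeasure M {0} < \<infinity>" by (rule compact_finite_measure) simp
  ultimately have "emeasure M {0} = 0"
  proof (cases "emeasure M {0}")
    case (real r)
    then have "ennreal r = ennreal (v \<pi> * r)" using \<open>emeasure M {0} = ennreal (v \<pi>) * _\<close> by (simp add: ennreal_mult)
    then have "r = v \<pi> * r" using real by simp
    then have "r = 0" using v_pi_less_1 by auto
    then show ?thesis using real by simp
  qed auto
  then show ?thesis using emeasure_translation[of "{0}" x] by simp
qed

text \<open>Finitely many translates of \<open>S\<close> cover any compact set, so a null
  \<open>S\<close> would make all compact sets null and, by inner regularity, the whole
  space.\<close>

lemma open_pos_measure:
  assumes "open S" "0 \<in> S" shows "emeasure M S > 0"
proof (rule ccontr)
  assume "\<not> emeasure M S > 0"
  then have S0: "emeasure M S = 0" by simp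
  have "emeasure M C = 0" if comp: "compact C" for C
  proof -
    obtain T where T: "T \<subseteq> C" "finite T" "C \<subseteq> (\<Union>t\<in>T. (+) t ` S)"
    proof (rule compactE_image[OF comp, of C "\<lambda>t. (+) t ` S"])
      show "C \<subseteq> (\<Union>t\<in>C. (+) t ` S)" using assms(2) by (auto intro!: bexI image_eqI[where x=0])
    qed (use assms open_translation_image in auto)
    have tb [simp]: "(+) t ` S \<in> sets borel" for t
      by (rule borel_open[OF open_translation_image[OF assms(1)]])
    have "emeasure M C \<le> emeasure M (\<Union>t\<in>T. (+) t ` S)"
      using T by (intro emeasure_mono) auto
    also have "\<dots> \<le> (\<Sum>t\<in>T. emeasure M ((+) t ` S))"
      using T by (intro emeasure_subadditive_finite) auto
    also have "\<dots> = 0" using S0 assms by (simp add: emeasure_translation)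
    finally show ?thesis by simp
  qed
  then have "(SUP C\<in>{C. compact C \<and> C \<subseteq> UNIV}. emeasure M C) \<le> 0"
    by (intro SUP_least) auto
  then have "emeasure M UNIV = 0" using inner_regular[of UNIV] by simp
  then show False using emeasure_UNIV_nonzero by simp
qed

lemma compact_nhd_0: obtains U C where "open U" "compact C" "0 \<in> U" "U \<subseteq> C" "0 < emeasure M C" "emeasure M C < \<infinity>"
proof -
  obtain U C where UC: "open U" "compact C" "(0::'k) \<in> U" "U \<subseteq> C"
    using locally_compact_local_field by blast
  have "emeasure M U \<le> emeasure M C" using UC borel_compact by (intro emeasure_mono) auto
  then show ?thesis using that UC open_pos_measure compact_finite_measure by (metis less_le_trans)
qed

text \<open>Outer regularity puts an open set of small measure around the null set
  \<open>{0}\<close>. For \<open>w\<close> near 0 the tube lemma moves \<open>w * C\<close> into it,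
  and for \<open>w \<noteq> 0\<close> the measure of \<open>w * C\<close> is \<open>v w\<close>
  times that of \<open>C\<close>.\<close>

lemma v_small_nhd_0:
  assumes "e > 0"
  obtains W where "open W" "0 \<in> W" "\<And>w. w \<in> W \<Longrightarrow> v w \<le> e"
proof -
  obtain U C where UC: "open U" "compact C" "(0::'k) \<in> U" "U \<subseteq> C" "0 < emeasure M C" "emeasure M C < \<infinity>"
    using compact_nhd_0 by metis
  have "(INF U\<in>{U. open U \<and> {0} \<subseteq> U}. emeasure M U) = emeasure M {0}"
    by (rule outer_regular[symmetric]) simp
  also have "\<dots> < ennreal e * emeasure M C"
    using UC assms singleton_null by (simp add: ennreal_zero_less_mult_iff)
  finally obtain O' where O: "open O'" "0 \<in> O'" "emeasure M O' < ennreal e * emeasure M C"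
    unfolding INF_less_iff by auto
  obtain W where W: "open W" "0 \<in> W" "\<And>w x. w \<in> W \<Longrightarrow> x \<in> C \<Longrightarrow> w * x \<in> O'"
    by (rule open_nhd_mult_compact[OF UC(2) O(1), of 0]) (simp add: O(2), blast)
  have "v w \<le> e" if "w \<in> W" for w
  proof (cases "w = 0")
    case False
    have "(*) w ` C \<subseteq> O'" using W that by auto
    then have "emeasure M ((*) w ` C) \<le> emeasure M O'" using O by (intro emeasure_mono) auto
    then have "ennreal (v w) * emeasure M C \<le> ennreal e * emeasure M C"
      using O False UC borel_compact by (subst (asm) emeasure_mult) auto
    then have "ennreal (v w) \<le> ennreal e"
      using UC by (metis ennreal_mult_le_mult_iff infinity_ennreal_def less_irrefl mult.commute top.not_eq_extremum)
    then show ?thesis using assms by simp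
  qed (use assms in auto)
  then show ?thesis using that W by metis
qed

text \<open>The same comparison at 1, with an open set around \<open>C\<close> of less than twice
  its measure; 2 stands for any constant greater than 1.\<close>

lemma v_nhd_1: obtains W where "open W" "1 \<in> W" "\<And>w. w \<in> W \<Longrightarrow> v w \<le> 2"
proof -
  obtain U C where UC: "open U" "compact C" "(0::'k) \<in> U" "U \<subseteq> C" "0 < emeasure M C" "emeasure M C < \<infinity>"
    using compact_nhd_0 by metis
  have "C \<in> sets borel" using UC borel_compact by blast
  then have "(INF U\<in>{U. open U \<and> C \<subseteq> U}. emeasure M U) = emeasure M C"
    by (rule outer_regular[symmetric])
  also have "\<dots> < 2 * emeasure M C"
  proof (cases "emeasure M C")
    case (real r)
    then have "r > 0" using UC(5) by auto
    then have "ennreal r < ennreal (2 * r)" by (simp add: ennreal_less_iff)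
    then show ?thesis using real by (simp add: ennreal_mult)
  qed (use UC in auto)
  finally obtain O' where O: "open O'" "C \<subseteq> O'" "emeasure M O' < ennreal 2 * emeasure M C"
    unfolding INF_less_iff by auto
  obtain W where W: "open W" "1 \<in> W" "\<And>w x. w \<in> W \<Longrightarrow> x \<in> C \<Longrightarrow> w * x \<in> O'"
    by (rule open_nhd_mult_compact[OF UC(2) O(1), of 1]) (use O(2) in force, blast)
  have "v w \<le> 2" if "w \<in> W" for w
  proof (cases "w = 0")
    case False
    have "(*) w ` C \<subseteq> O'" using W that by auto
    then have "emeasure M ((*) w ` C) \<le> emeasure M O'" using O by (intro emeasure_mono) auto
    then have "ennreal (v w) * emeasure M C \<le> ennreal 2 * emeasure M C"
      using O False UC borel_compact by (subst (asm) emeasure_mult) auto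
    then have "ennreal (v w) \<le> ennreal 2"
      using UC by (metis ennreal_mult_le_mult_iff infinity_ennreal_def less_irrefl mult.commute top.not_eq_extremum)
    then show ?thesis by (subst (asm) ennreal_le_iff) auto
  qed auto
  then show ?thesis using that W by metis
qed

text \<open>Applied to inverses, the bound near 1 also bounds \<open>v\<close> from below near every nonzero point.\<close>

lemma v_nhd:
  assumes "x \<noteq> 0"
  obtains W where "open W" "x \<in> W" "\<And>w. w \<in> W \<Longrightarrow> v w \<le> 2 * v x" "\<And>w. w \<in> W \<Longrightarrow> w \<noteq> 0 \<Longrightarrow> v x \<le> 2 * v w"
proof -
  obtain W1 where W1: "open W1" "1 \<in> W1" "\<And>w. w \<in> W1 \<Longrightarrow> v w \<le> 2" using v_nhd_1 by metis
  have "eventually (\<lambda>y. y \<in> W1) (nhds (inverse (1::'k)))" using W1 by (auto intro: eventually_nhds_in_open)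
  then have "eventually (\<lambda>y. inverse y \<in> W1) (nhds (1::'k))"
    using tendsto_inverse_local_field[OF one_neq_zero] unfolding filterlim_iff by blast
  then obtain W2 where W2: "open W2" "1 \<in> W2" "\<And>y. y \<in> W2 \<Longrightarrow> inverse y \<in> W1"
    by (auto simp: eventually_nhds)
  let ?W = "(*) x ` (W1 \<inter> W2)"
  show ?thesis
  proof (rule that[of ?W])
    show "open ?W" using W1 W2 assms by (intro open_mult_image) auto
    show "x \<in> ?W" using W1 W2 by (auto intro!: image_eqI[where x=1])
    fix w assume "w \<in> ?W"
    then obtain y where y: "w = x * y" "y \<in> W1" "y \<in> W2" by auto
    show "v w \<le> 2 * v x" using W1(3)[OF y(2)] by (simp add: y v_mult mult.commute mult_left_mono)
    assume "w \<noteq> 0"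
    then have "v y > 0" using y by auto
    have "inverse (v y) \<le> 2" using W1(3)[OF W2(3)[OF y(3)]] by (simp add: v_inverse)
    then have "1 \<le> 2 * v y" using \<open>v y > 0\<close> by (simp add: field_simps)
    then show "v x \<le> 2 * v w" using mult_left_mono[of 1 "2 * v y" "v x"] by (simp add: y v_mult algebra_simps)
  qed
qed

lemma v_bounded_compact:
  assumes "compact C" obtains R where "R > 0" "\<And>x. x \<in> C \<Longrightarrow> v x \<le> R"
proof -
  have "\<exists>W. open W \<and> x \<in> W \<and> (\<exists>R. \<forall>w\<in>W. v w \<le> R)" for x
  proof (cases "x = 0")
    case True then show ?thesis using v_small_nhd_0[of 1] by (metis zero_less_one)
  next
    case False then show ?thesis using v_nhd[of x] by metis
  qed
  then obtain W R where W: "\<And>x. open (W x)" "\<And>x. x \<in> W x" "\<And>x w. w \<in> W x \<Longrightarrow> v w \<le> R x" by metis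
  obtain T where T: "finite T" "C \<subseteq> (\<Union>t\<in>T. W t)"
  proof (rule compactE_image[OF assms, of C W])
    show "C \<subseteq> (\<Union>t\<in>C. W t)" using W(2) by auto
  qed (use W(1) in blast)+
  show ?thesis
  proof (rule that)
    fix x assume "x \<in> C"
    then obtain t where "t \<in> T" "v x \<le> R t" using T W by blast
    moreover have "R t \<le> (\<Sum>t\<in>T. \<bar>R t\<bar>)" using T(1) \<open>t \<in> T\<close> member_le_sum[of t T "\<lambda>t. \<bar>R t\<bar>"] by auto
    ultimately show "v x \<le> 1 + (\<Sum>t\<in>T. \<bar>R t\<bar>)" by simp
  next
    show "0 < 1 + (\<Sum>t\<in>T. \<bar>R t\<bar>)" by (simp add: add_pos_nonneg sum_nonneg)
  qed
qed

lemma v_bounded_below_compact: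
  assumes "compact C" "0 \<notin> C" obtains r where "r > 0" "\<And>x. x \<in> C \<Longrightarrow> v x \<ge> r"
proof -
  have "\<exists>W. open W \<and> x \<in> W \<and> (\<forall>w\<in>W. w \<noteq> 0 \<longrightarrow> v w \<ge> v x / 2)" if "x \<noteq> 0" for x
    using v_nhd[OF that] by (metis mult.commute divide_le_eq_numeral1(1))
  then obtain W where W: "\<And>x. x \<noteq> 0 \<Longrightarrow> open (W x)" "\<And>x. x \<noteq> 0 \<Longrightarrow> x \<in> W x"
      "\<And>x w. x \<noteq> 0 \<Longrightarrow> w \<in> W x \<Longrightarrow> w \<noteq> 0 \<Longrightarrow> v w \<ge> v x / 2" by metis
  obtain T where T: "finite T" "T \<subseteq> C" "C \<subseteq> (\<Union>t\<in>T. W t)"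
  proof (rule compactE_image[OF assms(1), of C W])
    have nz: "x \<noteq> 0" if "x \<in> C" for x using assms(2) that by metis
    show "open (W t)" if "t \<in> C" for t by (rule W(1)[OF nz[OF that]])
    show "C \<subseteq> (\<Union>t\<in>C. W t)" using W(2)[OF nz] by auto
  qed blast
  let ?r = "Min (insert 1 ((\<lambda>t. v t / 2) ` T))"
  show ?thesis
  proof (rule that)
    have "t \<noteq> 0" if "t \<in> T" for t using T(2) assms(2) that by auto
    then show "?r > 0" using T(1) by simp
    fix x assume x: "x \<in> C"
    then obtain t where t: "t \<in> T" "x \<in> W t" using T by blast
    have "t \<noteq> 0" "x \<noteq> 0" using x t(1) T(2) assms(2) by auto
    then have "v x \<ge> v t / 2" using W(3)[OF _ t(2)] by blast
    moreover have "?r \<le> v t / 2" using T(1) t(1) by (intro Min_le) auto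
    ultimately show "v x \<ge> ?r" by linarith
  qed
qed

text \<open>For a contraction \<open>r\<close> with
  \<open>r * C \<subseteq> U \<subseteq> C\<close>, consider the first \<open>n\<close> at which
  \<open>r ^ n * a\<close> enters \<open>C\<close>. Unless \<open>n = 0\<close>, it lands in the
  shell \<open>C - r * U\<close>, where \<open>v\<close> is bounded below;
  \<open>v a \<le> 1\<close> then bounds \<open>n\<close> uniformly, so a single dilate of
  \<open>C\<close> holds all of \<open>\<O>\<close>.\<close>

lemma integer_ring_in_compact: obtains C where "compact C" "\<O> \<subseteq> C"
proof -
  obtain U C where UC: "open U" "compact C" "(0::'k) \<in> U" "U \<subseteq> C"
    using compact_nhd_0 by metis
  obtain W where W: "open W" "0 \<in> W" "\<And>w x. w \<in> W \<Longrightarrow> x \<in> C \<Longrightarrow> w * x \<in> U"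
    by (rule open_nhd_mult_compact[OF UC(2) UC(1), of 0]) (simp add: UC(3), blast)
  obtain W' where W': "open W'" "0 \<in> W'" "\<And>w. w \<in> W' \<Longrightarrow> v w \<le> v \<pi>"
    using v_small_nhd_0[of "v \<pi>"] by (metis pi_nonzero v_pos_iff)
  have "open (W \<inter> W')" "0 \<in> W \<inter> W'" using W W' by auto
  then have "W \<inter> W' \<noteq> {0}" using not_open_singleton by metis
  \<comment> \<open>As 0 is not isolated, \<open>r\<close> can be nonzero; \<open>W\<close> yields
    \<open>r * C \<subseteq> U\<close>, and \<open>W'\<close> yields \<open>v r < 1\<close>.\<close>
  then obtain r where r: "r \<in> W" "v r \<le> v \<pi>" "r \<noteq> 0" using \<open>0 \<in> W \<inter> W'\<close> W' by auto
  then have r1: "v r < 1" using v_pi_less_1 by simp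
  have rC: "r * x \<in> C" if "x \<in> C" for x using W r UC that by blast
  have rnC: "r ^ n * x \<in> C" if "x \<in> C" for n x
    by (induction n) (use that rC in \<open>auto simp: mult.assoc\<close>)
  obtain R where R: "R > 0" "\<And>x. x \<in> C \<Longrightarrow> v x \<le> R" using v_bounded_compact[OF UC(2)] by metis
  \<comment> \<open>Otherwise the nested sets \<open>r ^ n * C - V\<close> would share a point
    \<open>z \<noteq> 0\<close>, with \<open>v z \<le> v r ^ n * R\<close> for every
    \<open>n\<close>.\<close>
  have base: "\<exists>n. \<forall>x\<in>C. r ^ n * x \<in> V" if V: "open V" "0 \<in> V" for V
  proof (rule ccontr)
    assume neg: "\<not> ?thesis"
    let ?f = "\<lambda>n. (*) (r ^ n) ` C - V"
    have "C \<inter> (\<Inter>n\<in>UNIV. ?f n) \<noteq> {}"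
    proof (rule compact_imp_fip_image[OF UC(2)])
      fix n show "closed (?f n)" using UC V compact_imp_closed compact_mult_image by blast
    next
      fix I' :: "nat set" assume I': "finite I'"
      let ?m = "Max (insert 0 I')"
      obtain x where x: "x \<in> C" "r ^ ?m * x \<notin> V" using neg by blast
      have "r ^ ?m * x \<in> ?f n" if "n \<in> I'" for n
      proof -
        have "n \<le> ?m" using that I' by auto
        then have "r ^ ?m * x = r ^ n * (r ^ (?m - n) * x)"
          by (simp only: mult.assoc[symmetric] power_add[symmetric]) simp
        then show ?thesis using x rnC by auto
      qed
      then show "C \<inter> (\<Inter>n\<in>I'. ?f n) \<noteq> {}" using rnC x by blast
    qed
    then obtain z where z: "\<And>n. z \<in> ?f n" by auto
    then have "z \<noteq> 0" using V by auto
    have "v z \<le> v r ^ n * R" for n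
    proof -
      obtain x where "x \<in> C" "z = r ^ n * x" using z[of n] by auto
      then show ?thesis using R by (auto simp: v_mult v_power intro!: mult_left_mono)
    qed
    then have "\<exists>N. \<forall>n\<ge>N. v z \<le> v r ^ n * R" by blast
    moreover have "(\<lambda>n. v r ^ n * R) \<longlonglongrightarrow> 0 * R"
      by (intro tendsto_mult LIMSEQ_power_zero tendsto_const) (use r1 in auto)
    ultimately have "v z \<le> 0 * R" using LIMSEQ_le_const by blast
    then have "v z \<le> 0" by simp
    then show False using \<open>z \<noteq> 0\<close> v_pos_iff[of z] by linarith
  qed
  \<comment> \<open>The factor \<open>a * inverse y\<close> takes some \<open>r ^ l * C\<close> into
    \<open>U\<close>; at the point \<open>r ^ l * y\<close> the value is
    \<open>r ^ l * a\<close>.\<close>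
  have absorb: "\<exists>n. r ^ n * a \<in> C" for a
  proof -
    have "U \<noteq> {0}" using UC(1) not_open_singleton by auto
    then obtain y where y: "y \<in> U" "y \<noteq> 0" using UC(3) by auto
    have "open ((\<lambda>x. a * inverse y * x + 0) -` U)" using UC(1) continuous_on_affine_map open_vimage by blast
    moreover have "0 \<in> (\<lambda>x. a * inverse y * x + 0) -` U" using UC by simp
    ultimately obtain l where l: "\<forall>x\<in>C. r ^ l * x \<in> (\<lambda>x. a * inverse y * x + 0) -` U" using base by blast
    then have "a * inverse y * (r ^ l * y) \<in> U" using y UC by auto
    also have "a * inverse y * (r ^ l * y) = r ^ l * a" using y(2) by (simp add: field_simps)
    finally show ?thesis using UC by auto
  qed
  have oU: "open ((*) r ` U)" using UC r by (intro open_mult_image) auto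
  let ?X = "C - (*) r ` U"
  have "compact ?X" using UC(2) oU by (intro compact_diff)
  moreover have "0 \<notin> ?X" using UC(3) by force
  ultimately obtain \<mu> where \<mu>: "\<mu> > 0" "\<And>x. x \<in> ?X \<Longrightarrow> v x \<ge> \<mu>" using v_bounded_below_compact by metis
  obtain N where N: "v r ^ N < \<mu>" using real_arch_pow_inv[OF \<mu>(1) r1] by blast
  let ?K = "(*) (inverse (r ^ N)) ` C"
  have "\<O> \<subseteq> ?K"
  proof
    fix a assume a: "a \<in> \<O>"
    define n where "n = (LEAST n. r ^ n * a \<in> C)"
    have n: "r ^ n * a \<in> C" unfolding n_def using absorb LeastI_ex by metis
    have "n \<le> N"
    proof (rule ccontr)
      assume "\<not> n \<le> N"
      then obtain m where m: "n = Suc m" "m \<ge> N" by (cases n) auto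
      have "r ^ m * a \<notin> C" using not_less_Least[of m "\<lambda>n. r ^ n * a \<in> C"] m(1) unfolding n_def by simp
      \<comment> \<open>Otherwise the exponent could be lowered by one, against the minimality of
        \<open>n\<close>.\<close>
      have "r ^ n * a \<notin> (*) r ` U"
      proof
        assume "r ^ n * a \<in> (*) r ` U"
        then have "r ^ m * a \<in> U" using r m by (auto simp: mult.assoc)
        then show False using \<open>r ^ m * a \<notin> C\<close> UC by auto
      qed
      then have "\<mu> \<le> v r ^ n * v a" using \<mu>(2)[of "r ^ n * a"] n by (simp add: v_mult v_power)
      also have "\<dots> \<le> v r ^ n" using a mult_left_le[of "v a" "v r ^ n"] by (simp add: integer_ring_def)
      also have "\<dots> \<le> v r ^ N" using \<open>\<not> n \<le> N\<close> r1 by (intro power_decreasing) auto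
      finally show False using N by simp
    qed
    then have "r ^ N * a = r ^ (N - n) * (r ^ n * a)"
      by (simp only: mult.assoc[symmetric] power_add[symmetric]) simp
    then have "r ^ N * a \<in> C" using rnC[OF n, of "N - n"] by metis
    moreover have "a = inverse (r ^ N) * (r ^ N * a)" using r by (simp flip: mult.assoc)
    ultimately show "a \<in> ?K" by (rule rev_image_eqI)
  qed
  then show ?thesis by (rule that[OF compact_mult_image[OF UC(2)]])
qed

lemma prime_p: "prime CHAR('k)"
  using prime_CHAR_semidom[where 'a='k] char_p p_pos by simp

lemma v_add: "v (x + y) \<le> max (v x) (v y)"
proof -
  obtain C where C: "compact C" "\<O> \<subseteq> C" using integer_ring_in_compact by metis
  let ?S = "{x + y |x y. x \<in> C \<and> y \<in> C}"
  have "\<exists>R>0. \<forall>z\<in>?S. v z \<le> R"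
  proof (rule v_bounded_compact[OF compact_plus[OF C(1) C(1)]])
    fix R assume "R > 0" "\<And>z. z \<in> ?S \<Longrightarrow> v z \<le> R"
    then show ?thesis by (intro exI[of _ R] conjI ballI)
  qed
  then obtain R where R: "R > 0" "\<And>z. z \<in> ?S \<Longrightarrow> v z \<le> R" by blast
  have R': "v (x + y) \<le> R" if "v x \<le> 1" "v y \<le> 1" for x y
  proof (rule R)
    have "x \<in> C" "y \<in> C" using that C(2) by (auto simp: integer_ring_def)
    then show "x + y \<in> {x + y |x y. x \<in> C \<and> y \<in> C}" by blast
  qed
  \<comment> \<open>By homogeneity: dividing by the larger term leaves a sum of two elements of
    \<open>\<O>\<close>.\<close>
  have bound: "v (x + y) \<le> R * max (v x) (v y)" for x y
  proof -
    have *: "v (x + y) \<le> R * v y" if "v x \<le> v y" for x y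
    proof (cases "y = 0")
      case False
      then have "v (x / y) \<le> 1" using that by (simp add: v_divide)
      then have "v (x / y + 1) \<le> R" by (intro R') simp_all
      then have "v ((x / y + 1) * y) \<le> R * v y" unfolding v_mult by (rule mult_right_mono) simp
      also have "(x / y + 1) * y = x + y" using False by (simp add: distrib_right)
      finally show ?thesis .
    next
      case True
      then have "x = 0" using that by simp
      then show ?thesis using True R by simp
    qed
    show ?thesis using *[of x y] *[of y x] R(1) by (cases "v x \<le> v y") (simp_all add: max_def add.commute)
  qed
  show ?thesis
  proof (cases "max (v x) (v y) = 0")
    case True
    then have "v x \<le> 0" "v y \<le> 0" by (metis max.cobounded1, metis max.cobounded2)
    then show ?thesis by simp
  next
    case False
    define m where "m = max (v x) (v y)"
    have m: "m > 0" using False v_nonneg[of x] unfolding m_def by linarith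
    show ?thesis
    proof (rule ccontr)
      assume "\<not> ?thesis"
      then have "m < v (x + y)" by (simp add: m_def not_le)
      then have g: "v (x + y) / m > 1" using m by simp
      obtain n where n: "(v (x + y) / m) ^ n > R" using real_arch_pow[OF g] by blast
      let ?q = "p ^ n"
      have "p \<ge> 2" using prime_p char_p prime_ge_2_nat by auto
      \<comment> \<open>Powers of sums split only at exponents that are powers of \<open>p\<close>;
        enlarging \<open>n\<close> to \<open>p ^ n\<close> keeps the ratio above
        \<open>R\<close>.\<close>
      then have "n \<le> ?q" by (metis less_exp less_imp_le_nat order_trans power_mono zero_le)
      then have "(v (x + y) / m) ^ n \<le> (v (x + y) / m) ^ ?q" using g by (intro power_increasing) auto
      then have "R < (v (x + y) / m) ^ ?q" using n by simp
      then have "R * m ^ ?q < v (x + y) ^ ?q" using m by (simp add: power_divide field_simps)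
      also have "\<dots> = v (x ^ ?q + y ^ ?q)"
        unfolding v_power[symmetric] by (subst freshmans_dream'[OF prime_p, of _ n]) (auto simp: char_p)
      also have "\<dots> \<le> R * max (v x ^ ?q) (v y ^ ?q)" using bound[of "x ^ ?q" "y ^ ?q"] by (simp add: v_power)
      also have "\<dots> \<le> R * m ^ ?q" using R by (intro mult_left_mono) (auto simp: m_def intro!: power_mono)
      finally show False by simp
    qed
  qed
qed

section \<open>The translation lattice\<close>

definition q :: nat where "q = p ^ c"

text \<open>The numerators of \<open>u_digit\<close>. Without the factor
  \<open>inverse \<pi>\<close> they are representatives of the residue field inside
  \<open>\<O>\<close>.\<close>

definition dig :: "nat \<Rightarrow> 'k" where
  "dig n = (\<Sum>i<c. of_nat (n div p ^ i mod p) * \<epsilon> i)"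

abbreviation "\<u> \<equiv> u p c \<pi> \<epsilon>"

lemma p_ge_2: "p \<ge> 2"
  using prime_p char_p prime_ge_2_nat by auto

lemma q_ge_2: "q \<ge> 2"
proof -
  have "p ^ 1 \<le> p ^ c" using p_ge_2 c_pos by (intro power_increasing) auto
  then show ?thesis using p_ge_2 by (simp add: q_def)
qed

lemma q_pos [simp]: "q > 0" and q_real_gt_1: "real q > 1" and q_real_pos: "real q > 0"
  using q_ge_2 by auto

lemma less_q_power: "n < q ^ n"
  using q_ge_2 less_exp[of n] power_mono[of 2 q n] by linarith

lemma v_diff: "v (x - y) \<le> max (v x) (v y)"
  using v_add[of x "-y"] by simp

lemma v_add_le: "v x \<le> r \<Longrightarrow> v y \<le> r \<Longrightarrow> v (x + y) \<le> r"
  using v_add[of x y] by simp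

lemma v_diff_le: "v x \<le> r \<Longrightarrow> v y \<le> r \<Longrightarrow> v (x - y) \<le> r"
  using v_diff[of x y] by simp

lemma v_add_eq: assumes "v x < v y" shows "v (x + y) = v y"
proof (rule antisym)
  show "v (x + y) \<le> v y" using assms by (intro v_add_le) auto
  have "v y \<le> max (v (x + y)) (v x)" using v_diff[of "x + y" x] by simp
  then show "v y \<le> v (x + y)" using assms by auto
qed

lemma v_sum_le: "(\<And>i. i \<in> S \<Longrightarrow> v (f i) \<le> r) \<Longrightarrow> r \<ge> 0 \<Longrightarrow> v (sum f S) \<le> r"
  by (induction S rule: infinite_finite_induct) (auto intro: v_add_le)

lemma v_of_nat_le: "v (of_nat n) \<le> 1"
  by (induction n) (auto intro: v_add_le)

lemma of_nat_mod_p: "of_nat (n mod p) = (of_nat n :: 'k)"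
proof -
  have "(of_nat n :: 'k) = of_nat (p * (n div p) + n mod p)" by simp
  also have "\<dots> = of_nat (n mod p)" using of_nat_CHAR[where 'a='k] char_p by (simp only: of_nat_add of_nat_mult) simp
  finally show ?thesis by simp
qed

lemma digits_exist:
  fixes a :: "nat \<Rightarrow> nat"
  assumes "b > 0" "\<And>i. i < m \<Longrightarrow> a i < b"
  shows "\<exists>n < b ^ m. \<forall>i<m. n div b ^ i mod b = a i"
  using assms(2)
proof (induction m)
  case (Suc m)
  then obtain n where n: "n < b ^ m" "\<forall>i<m. n div b ^ i mod b = a i" by force
  let ?n = "n + b ^ m * a m"
  have "?n < b ^ m + b ^ m * a m" using n by simp
  also have "\<dots> = b ^ m * Suc (a m)" by simp
  also have "\<dots> \<le> b ^ m * b" using Suc.prems[of m] by (intro mult_left_mono) auto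
  finally have "?n < b ^ Suc m" by (simp add: mult.commute)
  moreover have "?n div b ^ i mod b = a i" if "i < Suc m" for i
  proof (cases "i = m")
    case True then show ?thesis using n assms(1) Suc.prems[of m] by simp
  next
    case False
    then have i: "i < m" using that by simp
    then have "b ^ m = b ^ i * (b * b ^ (m - Suc i))"
      by (metis Suc_diff_Suc add_diff_inverse_nat less_imp_not_less power_Suc power_add)
    then have "?n div b ^ i = n div b ^ i + b * (b ^ (m - Suc i) * a m)"
      using assms(1) by (simp add: mult.assoc)
    then show ?thesis using n i by simp
  qed
  ultimately show ?case by blast
qed auto

text \<open>Coefficients may be reduced modulo \<open>p\<close> because \<open>p = 0\<close> in the
  field. So the \<open>q\<close> values of \<open>dig\<close> fill the whole span and are closed
  under addition and negation, without carries.\<close>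

lemma dig_exists: "\<exists>k<q. dig k = (\<Sum>i<c. of_nat (a i) * \<epsilon> i)"
proof -
  obtain k where "k < p ^ c" "\<forall>i<c. k div p ^ i mod p = a i mod p"
    using digits_exist[of p c "\<lambda>i. a i mod p"] p_pos by auto
  then have "dig k = (\<Sum>i<c. of_nat (a i) * \<epsilon> i)" unfolding dig_def
    by (intro sum.cong) (auto simp: of_nat_mod_p)
  then show ?thesis using \<open>k < p ^ c\<close> q_def by auto
qed

lemma dig_0 [simp]: "dig 0 = 0"
  by (simp add: dig_def)

lemma dig_add: "\<exists>k<q. dig k = dig n + dig m"
  using dig_exists[of "\<lambda>i. n div p ^ i mod p + m div p ^ i mod p"]
  by (simp add: dig_def distrib_right sum.distrib)

lemma of_nat_p_minus_1: "of_nat (p - 1) = (-1 :: 'k)"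
proof -
  have "of_nat (p - 1) + 1 = (of_nat p :: 'k)" using p_pos by (cases p) (simp_all add: add.commute)
  also have "\<dots> = 0" using of_nat_CHAR[where 'a='k] char_p by simp
  finally show ?thesis by (simp add: eq_neg_iff_add_eq_0)
qed

lemma dig_minus: "\<exists>k<q. dig k = - dig n"
proof -
  obtain k where k: "k < q" "dig k = (\<Sum>i<c. of_nat ((p - 1) * (n div p ^ i mod p)) * \<epsilon> i)"
    using dig_exists[of "\<lambda>i. (p - 1) * (n div p ^ i mod p)"] by auto
  have "dig k = - dig n" unfolding k(2) unfolding dig_def of_nat_mult of_nat_p_minus_1 by (simp add: sum_negf)
  then show ?thesis using k by blast
qed

lemma dig_in_O: "v (dig n) \<le> 1"
  unfolding dig_def
proof (rule v_sum_le)
  fix i assume "i \<in> {..<c}"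
  then have "v (\<epsilon> i) \<le> 1" using basis by (auto simp: residue_basis_def integer_ring_def)
  then show "v (of_nat (n div p ^ i mod p) * \<epsilon> i) \<le> 1"
    unfolding v_mult using v_of_nat_le by (intro mult_le_one) auto
qed simp

lemma basis_independent:
  assumes "\<And>i. i < c \<Longrightarrow> a i < p" "v (\<Sum>i<c. of_nat (a i) * \<epsilon> i) < 1" "i < c"
  shows "a i = 0"
  using basis[unfolded residue_basis_def, THEN conjunct2, THEN conjunct2, THEN conjunct1, rule_format, of a i]
    assms by (simp add: prime_ideal_def)

lemma dig_small: assumes "n < q" "v (dig n) < 1" shows "n = 0"
proof -
  have z: "\<forall>i<c. n div p ^ i mod p = 0"
    using basis_independent[of "\<lambda>i. n div p ^ i mod p"] assms(2) p_pos by (simp add: dig_def)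
  have "n mod p ^ m = 0" if "m \<le> c" for m using that
  proof (induction m)
    case (Suc m)
    then show ?case using z by (simp add: mod_mult2_eq mult.commute[of p])
  qed simp
  then show ?thesis using assms(1) q_def by fastforce
qed

lemma dig_inj: assumes "n < q" "m < q" "v (dig n - dig m) < 1" shows "n = m"
proof -
  have "\<forall>i<c. n div p ^ i mod p = m div p ^ i mod p"
  proof -
    \<comment> \<open>Independence concerns coefficients from 0 to \<open>p - 1\<close>, so a
      difference of digits is written as such a residue, with \<open>p - 1\<close> in the role of
      -1.\<close>
    let ?a = "\<lambda>i. (n div p ^ i mod p + (p - 1) * (m div p ^ i mod p)) mod p"
    have "of_nat (?a i) = (of_nat (n div p ^ i mod p) - of_nat (m div p ^ i mod p) :: 'k)" for i
      unfolding of_nat_mod_p[of "_ + _"] of_nat_add of_nat_mult of_nat_p_minus_1 by simp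
    then have "(\<Sum>i<c. of_nat (?a i) * \<epsilon> i) = dig n - dig m"
      by (simp add: dig_def left_diff_distrib sum_subtractf)
    then have a0: "\<forall>i<c. ?a i = 0" using basis_independent[of ?a] assms(3) p_pos by simp
    have "n div p ^ i mod p = m div p ^ i mod p" if "i < c" for i
    proof -
      define x y where "x = n div p ^ i mod p" and "y = m div p ^ i mod p"
      have "(x + (p - 1) * y) mod p = 0" using a0 that by (simp add: x_def y_def)
      moreover have "x + (p - 1) * y + y = x + p * y" using p_pos by (cases p) auto
      ultimately have "(0 + y) mod p = (x + p * y) mod p" by (metis mod_add_left_eq)
      then show ?thesis by (simp add: x_def y_def)
    qed
    then show ?thesis by blast
  qed
  then have "n mod p ^ k = m mod p ^ k" if "k \<le> c" for k using that
  proof (induction k)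
    case (Suc k)
    then show ?case by (simp add: mod_mult2_eq mult.commute[of p])
  qed simp
  then show ?thesis using assms q_def by (metis mod_less order_refl)
qed

lemma dig_unit: "n < q \<Longrightarrow> n \<noteq> 0 \<Longrightarrow> v (dig n) = 1"
  using dig_small[of n] dig_in_O[of n] by fastforce

lemma residue_dig: assumes "v x \<le> 1" shows "\<exists>k<q. v (x - dig k) < 1"
proof -
  obtain a where "v (x - (\<Sum>i<c. of_nat (a i) * \<epsilon> i)) < 1"
    using basis assms unfolding residue_basis_def prime_ideal_def integer_ring_def by blast
  then show ?thesis using dig_exists[of a] by metis
qed

text \<open>\<open>\<O>\<close> is the disjoint union of \<open>q\<close> translates of
  \<open>\<pi> * \<O>\<close>, which is the prime ideal; each has measure \<open>v \<pi>\<close>,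
  and together they have measure 1.\<close>

lemma v_pi: "v \<pi> = 1 / real q"
proof -
  let ?P = "(*) \<pi> ` \<O>"
  have P: "?P = {x. v x < 1}"
  proof (intro set_eqI iffI)
    fix x assume "x \<in> ?P"
    then obtain y where y: "x = \<pi> * y" "v y \<le> 1" by (auto simp: integer_ring_def)
    have "v x \<le> v \<pi> * 1" unfolding y(1) v_mult using y(2) by (intro mult_left_mono) auto
    then show "x \<in> {x. v x < 1}" using v_pi_less_1 by simp
  next
    fix x assume "x \<in> {x. v x < 1}"
    then have "v (x / \<pi>) \<le> 1" using v_le_v_pi[of x] by (simp add: v_divide)
    moreover have "x = \<pi> * (x / \<pi>)" by simp
    ultimately show "x \<in> ?P" by (metis (mono_tags) image_eqI integer_ring_def mem_Collect_eq)
  qed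
  have O: "\<O> = (\<Union>k<q. (+) (dig k) ` ?P)"
  proof (intro set_eqI iffI)
    fix x assume "x \<in> \<O>"
    then obtain k where k: "k < q" "v (x - dig k) < 1" using residue_dig by (auto simp: integer_ring_def)
    moreover have "x = dig k + (x - dig k)" by simp
    ultimately show "x \<in> (\<Union>k<q. (+) (dig k) ` ?P)" unfolding P by blast
  next
    fix x assume "x \<in> (\<Union>k<q. (+) (dig k) ` ?P)"
    then obtain k y where "x = dig k + y" "v y < 1" unfolding P by blast
    then show "x \<in> \<O>" using dig_in_O by (auto simp: integer_ring_def intro!: v_add_le)
  qed
  have P_borel: "?P \<in> sets borel" by (rule borel_mult_image) auto
  have tb: "(+) a ` ?P \<in> sets borel" for a
    unfolding translation_image_eq_vimage
    by (rule measurable_sets_borel[OF borel_measurable_continuous_onI[OF continuous_on_affine_map] P_borel])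
  have disj: "disjoint_family_on (\<lambda>k. (+) (dig k) ` ?P) {..<q}"
    unfolding disjoint_family_on_def
  proof (intro ballI impI)
    fix k l assume kl: "k \<in> {..<q}" "l \<in> {..<q}" "k \<noteq> l"
    show "(+) (dig k) ` ?P \<inter> (+) (dig l) ` ?P = {}"
    proof (rule ccontr)
      assume "\<not> ?thesis"
      then obtain x y where xy: "v x < 1" "v y < 1" "dig k + x = dig l + y" unfolding P by blast
      then have "dig k - dig l = y - x" by (simp add: algebra_simps)
      then have "v (dig k - dig l) < 1" using xy v_diff[of y x] by auto
      then show False using dig_inj kl by auto
    qed
  qed
  have "1 = emeasure M (\<Union>k<q. (+) (dig k) ` ?P)" using O integer_ring_measure by simp
  also have "\<dots> = (\<Sum>k<q. emeasure M ((+) (dig k) ` ?P))"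
    using disj tb by (intro sum_emeasure[symmetric]) auto
  also have "\<dots> = (\<Sum>k<q. ennreal (v \<pi>))"
    using P_borel by (simp add: emeasure_translation emeasure_mult integer_ring_measure)
  also have "\<dots> = ennreal (real q * v \<pi>)" by (simp add: ennreal_mult ennreal_of_nat_eq_real_of_nat)
  finally have "ennreal 1 = ennreal (real q * v \<pi>)" by simp
  then have "real q * v \<pi> = 1" by (subst (asm) ennreal_inj) auto
  then show ?thesis by (simp add: field_simps)
qed

lemma v_inv_pi [simp]: "v (inverse \<pi>) = real q"
  by (simp add: v_inverse v_pi)

lemma v_pi_powi: "v (\<pi> powi j) = real q powi (-j)"
  by (simp add: v_power_int v_pi power_int_divide_distrib power_int_minus_divide)

lemma v_inv_pi_power: "v (inverse \<pi> ^ n) = real q ^ n"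
  by (simp add: v_power)

section \<open>Lattice points: digits, group law and size\<close>

lemma sum_lessThan_add: "sum f {..<N + m} = sum f {..<N} + (\<Sum>k<m. f (N + k :: nat) :: 'k)"
  by (induction m) (auto simp: add.assoc)

text \<open>The number of summands in the definition depends on \<open>n\<close>; a common length
  \<open>T\<close> lets the digits of different indices be compared. Terms past the last digit
  vanish since \<open>dig 0 = 0\<close>.\<close>

lemma u_eq_sum:
  assumes "n < q ^ T"
  shows "\<u> n = (\<Sum>k<T. dig (n div q ^ k mod q) * inverse \<pi> ^ Suc k)"
proof -
  let ?f = "\<lambda>k. dig (n div q ^ k mod q) * inverse \<pi> ^ Suc k"
  have z: "?f k = 0" if "n < q ^ k" for k using that by simp
  have "\<u> n = sum ?f {..n}"
    unfolding u_def u_digit_def dig_def q_def by (intro sum.cong) (auto simp: mult.assoc)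
  also have "\<dots> = sum ?f {..<T + Suc n}"
  proof (rule sum.mono_neutral_left)
    show "\<forall>i\<in>{..<T + Suc n} - {..n}. ?f i = 0"
      using z less_q_power by (metis DiffE atMost_iff less_trans not_le)
  qed auto
  also have "\<dots> = sum ?f {..<T}"
  proof (rule sum.mono_neutral_right)
    show "\<forall>i\<in>{..<T + Suc n} - {..<T}. ?f i = 0"
    proof
      fix i assume "i \<in> {..<T + Suc n} - {..<T}"
      then have "q ^ T \<le> q ^ i" using q_ge_2 by (intro power_increasing) auto
      then show "?f i = 0" using z assms by simp
    qed
  qed auto
  finally show ?thesis .
qed

lemma u_digit_small: "n < q \<Longrightarrow> \<u> n = dig n * inverse \<pi>"
  using u_eq_sum[of n 1] by simp

lemma u_0 [simp]: "\<u> 0 = 0"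
  using u_digit_small[of 0] by simp

text \<open>The base \<open>q\<close> digits of \<open>n\<close> and of \<open>q ^ N * m\<close>
  occupy disjoint positions. Splitting indices into blocks thus becomes the coset decomposition of
  \<Lambda> by the sublattice scaled by \<open>inverse \<pi> ^ N\<close>.\<close>

lemma u_shift:
  assumes "n < q ^ N"
  shows "\<u> (n + q ^ N * m) = \<u> n + inverse \<pi> ^ N * \<u> m"
proof -
  let ?x = "n + q ^ N * m"
  let ?f = "\<lambda>k. dig (?x div q ^ k mod q) * inverse \<pi> ^ Suc k"
  have m: "m < q ^ m" by (rule less_q_power)
  have "?x < q ^ N + q ^ N * m" using assms by simp
  also have "\<dots> = q ^ N * Suc m" by simp
  also have "\<dots> \<le> q ^ N * q ^ m" using m by (intro mult_left_mono) auto
  finally have "?x < q ^ (N + m)" by (simp add: power_add)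
  then have "\<u> ?x = sum ?f {..<N + m}" by (rule u_eq_sum)
  also have "\<dots> = sum ?f {..<N} + (\<Sum>k<m. ?f (N + k))"
    by (rule sum_lessThan_add)
  also have "sum ?f {..<N} = \<u> n"
    unfolding u_eq_sum[OF assms]
  proof (rule sum.cong)
    fix k assume "k \<in> {..<N}"
    then have "q ^ N = q ^ k * (q * q ^ (N - Suc k))"
      by (metis Suc_diff_Suc add_diff_inverse_nat less_imp_not_less lessThan_iff power_Suc power_add)
    then have "?x div q ^ k = n div q ^ k + q * (q ^ (N - Suc k) * m)"
      by (simp add: mult.assoc)
    then show "?f k = dig (n div q ^ k mod q) * inverse \<pi> ^ Suc k" by simp
  qed simp
  also have "(\<Sum>k<m. ?f (N + k)) = inverse \<pi> ^ N * \<u> m"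
    unfolding u_eq_sum[OF m] sum_distrib_left
  proof (rule sum.cong)
    fix k
    have "?x div q ^ (N + k) = m div q ^ k" using assms by (simp add: power_add div_mult2_eq)
    then show "?f (N + k) = inverse \<pi> ^ N * (dig (m div q ^ k mod q) * inverse \<pi> ^ Suc k)"
      by (simp add: power_add mult_ac)
  qed simp
  finally show ?thesis .
qed

lemma u_mult_pow: "\<u> (q ^ N * m) = inverse \<pi> ^ N * \<u> m"
  using u_shift[of 0 N m] by simp

lemma less_q_power_Suc:
  assumes "n < q ^ Suc N"
  obtains n0 n1 where "n = n0 + q ^ N * n1" "n0 < q ^ N" "n1 < q"
proof (rule that)
  show "n = n mod q ^ N + q ^ N * (n div q ^ N)" by simp
  show "n mod q ^ N < q ^ N" by simp
  show "n div q ^ N < q" using assms by (simp add: less_mult_imp_div_less mult.commute)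
qed

lemma u_decomp_less: "n0 < q ^ N \<Longrightarrow> n1 < q \<Longrightarrow> n0 + q ^ N * n1 < q ^ Suc N"
proof -
  assume a: "n0 < q ^ N" "n1 < q"
  then have "n0 + q ^ N * n1 < q ^ N * Suc n1" by simp
  also have "\<dots> \<le> q ^ N * q" using a by (intro mult_left_mono) auto
  finally show ?thesis by (simp add: mult.commute)
qed

text \<open>Addition is free of carries: \<open>dig_add\<close> treats the leading digits and
  induction the lower blocks, so the index bound reproduces itself.\<close>

lemma u_add_bounded:
  "n < q ^ N \<Longrightarrow> m < q ^ N \<Longrightarrow> \<exists>k < q ^ N. \<u> k = \<u> n + \<u> m"
proof (induction N arbitrary: n m)
  case 0
  then show ?case by auto
next
  case (Suc N)
  obtain n0 n1 where n: "n = n0 + q ^ N * n1" "n0 < q ^ N" "n1 < q" using less_q_power_Suc Suc.prems by metis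
  obtain m0 m1 where m: "m = m0 + q ^ N * m1" "m0 < q ^ N" "m1 < q" using less_q_power_Suc Suc.prems by metis
  obtain k0 where k0: "k0 < q ^ N" "\<u> k0 = \<u> n0 + \<u> m0" using Suc.IH n m by blast
  obtain k1 where k1: "k1 < q" "dig k1 = dig n1 + dig m1" using dig_add by blast
  have "\<u> (k0 + q ^ N * k1) = \<u> n + \<u> m"
    unfolding n(1) m(1) u_shift[OF k0(1)] u_shift[OF n(2)] u_shift[OF m(2)]
    using k0 k1 n m by (simp add: u_digit_small algebra_simps)
  then show ?case using u_decomp_less k0 k1 by blast
qed

lemma u_minus_bounded:
  "n < q ^ N \<Longrightarrow> \<exists>k < q ^ N. \<u> k = - \<u> n"
proof (induction N arbitrary: n)
  case 0
  then show ?case by auto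
next
  case (Suc N)
  obtain n0 n1 where n: "n = n0 + q ^ N * n1" "n0 < q ^ N" "n1 < q" using less_q_power_Suc Suc.prems by metis
  obtain k0 where k0: "k0 < q ^ N" "\<u> k0 = - \<u> n0" using Suc.IH n by blast
  obtain k1 where k1: "k1 < q" "dig k1 = - dig n1" using dig_minus by blast
  have "\<u> (k0 + q ^ N * k1) = - \<u> n"
    unfolding n(1) u_shift[OF k0(1)] u_shift[OF n(2)]
    using k0 k1 n by (simp add: u_digit_small algebra_simps)
  then show ?case using u_decomp_less k0 k1 by blast
qed

lemma u_add: "\<exists>k. \<u> k = \<u> n + \<u> m"
  and u_minus: "\<exists>k. \<u> k = - \<u> n"
proof -
  have "n < q ^ (n + m)" "m < q ^ (n + m)"
    using less_q_power[of "n + m"] by linarith+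
  then show "\<exists>k. \<u> k = \<u> n + \<u> m" "\<exists>k. \<u> k = - \<u> n"
    using u_add_bounded u_minus_bounded by metis+
qed

lemma u_diff: "\<exists>k. \<u> k = \<u> n - \<u> m"
  using u_minus[of m] u_add[of n] by (metis diff_conv_add_uminus)

lemma v_u_le: "n < q ^ N \<Longrightarrow> v (\<u> n) \<le> real q ^ N"
proof (induction N arbitrary: n)
  case (Suc N)
  obtain n0 n1 where n: "n = n0 + q ^ N * n1" "n0 < q ^ N" "n1 < q" using less_q_power_Suc Suc.prems by metis
  have "real q ^ N \<le> real q ^ Suc N" using q_real_gt_1 by (intro power_increasing) auto
  then have "v (\<u> n0) \<le> real q ^ Suc N" using Suc.IH[OF n(2)] by linarith
  moreover have "v (inverse \<pi> ^ N * \<u> n1) \<le> real q ^ Suc N"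
    using n dig_in_O[of n1] by (simp add: u_digit_small v_mult v_inv_pi_power mult_left_le)
  ultimately show ?case unfolding n(1) u_shift[OF n(2)] by (rule v_add_le)
qed simp

text \<open>The leading digit is a unit, and its term strictly dominates the lower block. The
  exponent is \<open>Suc N\<close> because each digit carries one more factor
  \<open>inverse \<pi>\<close>.\<close>

lemma v_u_eq: assumes "q ^ N \<le> n" "n < q ^ Suc N" shows "v (\<u> n) = real q ^ Suc N"
proof -
  obtain n0 n1 where n: "n = n0 + q ^ N * n1" "n0 < q ^ N" "n1 < q" using less_q_power_Suc assms by metis
  then have "n1 \<noteq> 0" using assms by (intro notI) simp
  then have 1: "v (inverse \<pi> ^ N * \<u> n1) = real q ^ Suc N"
    using n by (simp add: u_digit_small v_mult v_inv_pi_power dig_unit)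
  have "v (\<u> n0) \<le> real q ^ N" using n v_u_le by blast
  also have "\<dots> < real q ^ Suc N" using q_real_gt_1 by (intro power_strict_increasing) auto
  finally show ?thesis unfolding n(1) u_shift[OF n(2)] using 1 v_add_eq by metis
qed

lemma v_u_gt: assumes "q ^ N \<le> n" shows "v (\<u> n) > real q ^ N"
proof -
  define L where "L = (LEAST L. n < q ^ L)"
  have L: "n < q ^ L" unfolding L_def using less_q_power by (rule LeastI)
  have "L > N"
  proof (rule ccontr)
    assume "\<not> L > N"
    then have "q ^ L \<le> q ^ N" using q_ge_2 by (intro power_increasing) auto
    then show False using L assms by simp
  qed
  then obtain L' where L': "L = Suc L'" "N \<le> L'" by (cases L) auto
  then have "q ^ L' \<le> n" using not_less_Least[of L' "\<lambda>L. n < q ^ L"] unfolding L_def by simp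
  then have "v (\<u> n) = real q ^ Suc L'" using v_u_eq L L' by blast
  also have "\<dots> > real q ^ N" using q_real_gt_1 L' by (intro power_strict_increasing) auto
  finally show ?thesis .
qed

text \<open>Initial index ranges are the lattice points of discs, so lattice points in a disc can be
  counted through indices below a power of \<open>q\<close>.\<close>

lemma v_u_le_iff: "v (\<u> n) \<le> real q ^ N \<longleftrightarrow> n < q ^ N"
  using v_u_le[of n N] v_u_gt[of N n] by (meson leI not_le)

lemma u_inj_bounded: "n < q ^ N \<Longrightarrow> m < q ^ N \<Longrightarrow> \<u> n = \<u> m \<Longrightarrow> n = m"
proof (induction N arbitrary: n m)
  case (Suc N)
  obtain n0 n1 where n: "n = n0 + q ^ N * n1" "n0 < q ^ N" "n1 < q" using less_q_power_Suc Suc.prems by metis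
  obtain m0 m1 where m: "m = m0 + q ^ N * m1" "m0 < q ^ N" "m1 < q" using less_q_power_Suc Suc.prems by metis
  have "\<u> n0 + inverse \<pi> ^ N * \<u> n1 = \<u> m0 + inverse \<pi> ^ N * \<u> m1"
    using Suc.prems(3) unfolding n(1) m(1) u_shift[OF n(2)] u_shift[OF m(2)] .
  then have e: "inverse \<pi> ^ N * (\<u> n1 - \<u> m1) = \<u> m0 - \<u> n0" by (simp add: algebra_simps)
  \<comment> \<open>The lower blocks differ by at most \<open>q ^ N\<close>, while distinct leading
    digits would contribute \<open>q ^ Suc N\<close>.\<close>
  have "v (\<u> m0 - \<u> n0) \<le> real q ^ N" using v_u_le n m by (intro v_diff_le) auto
  then have "real q ^ N * v (\<u> n1 - \<u> m1) \<le> real q ^ N * 1"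
    unfolding e[symmetric] by (simp add: v_mult v_inv_pi_power)
  then have "v (\<u> n1 - \<u> m1) \<le> 1" using q_real_pos by simp
  also have "\<u> n1 - \<u> m1 = (dig n1 - dig m1) * inverse \<pi>" using n m by (simp add: u_digit_small algebra_simps)
  finally have "v (dig n1 - dig m1) * real q \<le> 1" by (simp add: v_mult)
  then have "v (dig n1 - dig m1) \<le> 1 / real q" using q_real_pos by (simp add: field_simps)
  also have "\<dots> < 1" using q_real_gt_1 by simp
  finally have "n1 = m1" using dig_inj n m by blast
  then have "n0 = m0" using e Suc.IH[OF n(2) m(2)] by simp
  then show ?case using n m \<open>n1 = m1\<close> by simp
qed simp

lemma u_inj: "inj \<u>"
proof (rule injI)
  fix n m assume "\<u> n = \<u> m"
  moreover have "n < q ^ (n + m)" "m < q ^ (n + m)"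
    using less_q_power[of "n + m"] by linarith+
  ultimately show "n = m" using u_inj_bounded by blast
qed

text \<open>Translation by a lattice point permutes \<Lambda>, and \<open>u\<close> is injective;
  hence the shift only permutes the terms of a nonnegative series.\<close>

lemma suminf_u_shift:
  fixes h :: "'k \<Rightarrow> ennreal"
  shows "(\<Sum>k. h (\<u> k + \<u> d)) = (\<Sum>k. h (\<u> k))"
proof -
  have "\<exists>s. \<forall>k. \<u> (s k) = \<u> k + \<u> d" by (intro choice allI u_add)
  then obtain s where s: "\<And>k. \<u> (s k) = \<u> k + \<u> d" by blast
  have "bij s"
  proof (rule bijI)
    show "inj s" by (rule injI) (metis s add_right_cancel u_inj injD)
    show "surj s"
    proof (rule surjI)
      fix n
      show "s (SOME k. \<u> k = \<u> n - \<u> d) = n"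
        using someI_ex[OF u_diff[of n d]] s u_inj by (metis (no_types, lifting) diff_add_cancel injD)
    qed
  qed
  have "(\<Sum>k. h (\<u> k + \<u> d)) = (\<integral>\<^sup>+k. h (\<u> (s k)) \<partial>count_space UNIV)"
    by (simp add: s nn_integral_count_space_nat)
  also have "\<dots> = (\<Sum>k. h (\<u> k))"
    using nn_integral_bij_count_space[of s UNIV UNIV "\<lambda>k. h (\<u> k)"] \<open>bij s\<close>
    by (simp add: nn_integral_count_space_nat)
  finally show ?thesis .
qed

end

section \<open>Coefficient sums of a single generator\<close>

text \<open>Counting measure makes Tonelli and monotone convergence available for sums over levels,
  which are indexed by \<open>int\<close>.\<close>

lemma infsum_ennreal_conv_nn_integral:
  fixes f :: "'a \<Rightarrow> ennreal"
  assumes "countable I"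
  shows "(\<Sum>\<^sub>\<infinity>i\<in>I. f i) = (\<integral>\<^sup>+i. f i \<partial>count_space I)"
proof (cases "finite I")
  case True
  then show ?thesis by (simp add: nn_integral_count_space_finite)
next
  case False
  let ?g = "from_nat_into I"
  have b: "bij_betw ?g UNIV I" using bij_betw_from_nat_into assms False by blast
  have "(\<lambda>n. f (?g n)) summable_on UNIV" by (rule nonneg_summable_on_complete) simp
  then have "(\<lambda>n. f (?g n)) sums (\<Sum>\<^sub>\<infinity>n. f (?g n))"
    by (intro has_sum_imp_sums has_sum_infsum)
  then have "(\<Sum>\<^sub>\<infinity>n. f (?g n)) = (\<Sum>n. f (?g n))" by (rule sums_unique)
  then show ?thesis
    unfolding infsum_reindex_bij_betw[OF b, symmetric] nn_integral_bij_count_space[OF b, symmetric]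
    by (simp add: nn_integral_count_space_nat)
qed

lemma nn_integral_count_space_Times:
  fixes f :: "'a \<times> 'b \<Rightarrow> ennreal"
  shows "(\<integral>\<^sup>+z. f z \<partial>count_space (A \<times> UNIV)) = (\<integral>\<^sup>+x. \<integral>\<^sup>+y. f (x, y) \<partial>count_space UNIV \<partial>count_space A)"
proof -
  have "(\<integral>\<^sup>+z. f z \<partial>count_space (A \<times> UNIV)) = (\<integral>\<^sup>+z. f z * indicator (A \<times> UNIV) z \<partial>count_space UNIV)"
    by (simp add: nn_integral_count_space_indicator)
  also have "\<dots> = (\<integral>\<^sup>+x. \<integral>\<^sup>+y. f (x, y) * indicator (A \<times> UNIV) (x, y) \<partial>count_space UNIV \<partial>count_space UNIV)"
    by (rule nn_integral_fst_count_space[symmetric])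
  also have "\<dots> = (\<integral>\<^sup>+x. (\<integral>\<^sup>+y. f (x, y) \<partial>count_space UNIV) * indicator A x \<partial>count_space UNIV)"
    by (intro nn_integral_cong) (auto simp: indicator_def)
  finally show ?thesis by (simp add: nn_integral_count_space_indicator)
qed

text \<open>Monotone convergence along the exhaustion \<open>j \<ge> - J\<close>; this is the limit
  in \<open>J\<close> for upper bounds.\<close>

lemma nn_integral_int_le:
  fixes F :: "int \<Rightarrow> ennreal"
  assumes "\<And>J::nat. (\<integral>\<^sup>+j. F j * indicator {- int J..} j \<partial>count_space UNIV) \<le> C"
  shows "(\<integral>\<^sup>+j. F j \<partial>count_space UNIV) \<le> C"
proof -
  let ?G = "\<lambda>(J::nat) j. F j * indicator {- int J..} j"
  have "F j = (SUP J. ?G J j)" for j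
  proof (rule antisym)
    show "F j \<le> (SUP J. ?G J j)"
      by (rule SUP_upper2[of "nat \<bar>j\<bar>"]) auto
    show "(SUP J. ?G J j) \<le> F j" by (intro SUP_least) (auto simp: indicator_def)
  qed
  then have "(\<integral>\<^sup>+j. F j \<partial>count_space UNIV) = (\<integral>\<^sup>+j. (SUP J. ?G J j) \<partial>count_space UNIV)" by simp
  also have "\<dots> = (SUP J. \<integral>\<^sup>+j. ?G J j \<partial>count_space UNIV)"
    by (rule nn_integral_monotone_convergence_SUP) (auto simp: incseq_def le_fun_def indicator_def)
  also have "\<dots> \<le> C" using assms by (intro SUP_least)
  finally show ?thesis .
qed

lemma nn_integral_int_split:
  fixes F :: "int \<Rightarrow> ennreal"
  shows "(\<integral>\<^sup>+j. F j \<partial>count_space UNIV) =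
    (\<integral>\<^sup>+j. F j * indicator {a..} j \<partial>count_space UNIV) + (\<integral>\<^sup>+j. F j * indicator {..<a} j \<partial>count_space UNIV)"
proof -
  have "(\<integral>\<^sup>+j. F j \<partial>count_space UNIV) = (\<integral>\<^sup>+j. F j * indicator {a..} j + F j * indicator {..<a} j \<partial>count_space UNIV)"
    by (intro nn_integral_cong) (auto simp: indicator_def)
  then show ?thesis by (simp add: nn_integral_add)
qed

lemma nn_integral_int_shift:
  fixes F :: "int \<Rightarrow> ennreal"
  shows "(\<integral>\<^sup>+j. F (j + a) \<partial>count_space UNIV) = (\<integral>\<^sup>+j. F j \<partial>count_space UNIV)"
proof (rule nn_integral_bij_count_space)
  show "bij_betw (\<lambda>j. j + a) UNIV UNIV"
    by (rule bij_betw_byWitness[where f' = "\<lambda>j. j - a"]) auto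
qed

text \<open>\<open>Suc m\<close> appears because level \<open>- J\<close> itself belongs to the
  other half of the split.\<close>

lemma nn_integral_int_less:
  fixes F :: "int \<Rightarrow> ennreal"
  shows "(\<integral>\<^sup>+j. F j * indicator {..<- int J} j \<partial>count_space UNIV) = (\<Sum>m. F (- int (J + Suc m)))"
proof -
  have b: "bij_betw (\<lambda>m. - int (J + Suc m)) UNIV {..<- int J}"
    by (rule bij_betw_byWitness[where f' = "\<lambda>j. nat (- j) - Suc J"]) auto
  have "(\<integral>\<^sup>+j. F j * indicator {..<- int J} j \<partial>count_space UNIV) = (\<integral>\<^sup>+j. F j \<partial>count_space {..<- int J})"
    by (simp add: nn_integral_count_space_indicator)
  also have "\<dots> = (\<integral>\<^sup>+m. F (- int (J + Suc m)) \<partial>count_space UNIV)"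
    by (rule nn_integral_bij_count_space[OF b, symmetric])
  finally show ?thesis by (simp add: nn_integral_count_space_nat)
qed

lemma sum_mult_div:
  fixes F :: "nat \<Rightarrow> 'a::comm_monoid_add"
  assumes "b > 0"
  shows "(\<Sum>n<a * b. F n) = (\<Sum>m<a. \<Sum>i<b. F (i + b * m))"
proof -
  have "sum F {m * b..<m * b + b} = (\<Sum>i<b. F (i + b * m))" for m
    using sum.shift_bounds_nat_ivl[of F 0 "m * b" b]
    by (simp add: atLeast0LessThan add.commute mult.commute)
  then show ?thesis using sum.nat_group[of F b a] by simp
qed

lemma suminf_ennreal_group:
  fixes F :: "nat \<Rightarrow> ennreal"
  assumes "b > 0"
  shows "(\<Sum>n. F n) = (\<Sum>i<b. \<Sum>m. F (i + b * m))"
proof -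
  have "F sums (\<Sum>n. F n)" by (simp add: summable_sums)
  then have "(\<lambda>n. sum F {n * b..<n * b + b}) sums (\<Sum>n. F n)" using assms by (rule sums_group)
  moreover have "sum F {m * b..<m * b + b} = (\<Sum>i<b. F (i + b * m))" for m
    using sum.shift_bounds_nat_ivl[of F 0 "m * b" b]
    by (simp add: atLeast0LessThan add.commute mult.commute)
  ultimately have "(\<Sum>n. F n) = (\<Sum>m. \<Sum>i<b. F (i + b * m))" by (simp add: sums_unique)
  then show ?thesis by (simp add: suminf_sum)
qed

section \<open>Energies, coefficients and Cauchy-Schwarz\<close>

definition energy :: "'k measure \<Rightarrow> ('k \<Rightarrow> complex) \<Rightarrow> ennreal" where
  "energy M f = (\<integral>\<^sup>+x. ennreal ((cmod (f x))\<^sup>2) \<partial>M)"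

definition coeff :: "'k measure \<Rightarrow> ('k \<Rightarrow> complex) \<Rightarrow> ('k \<Rightarrow> complex) \<Rightarrow> ennreal" where
  "coeff M f h = ennreal ((cmod (inner_L2 M f h))\<^sup>2)"

lemma borel_measurable_cnj [measurable]:
  "f \<in> borel_measurable M \<Longrightarrow> (\<lambda>x. cnj (f x)) \<in> borel_measurable M"
  by (rule borel_measurable_continuous_on[OF continuous_on_cnj[OF continuous_on_id]])

lemma L2_iff: "f \<in> L2 M \<longleftrightarrow> f \<in> borel_measurable M \<and> energy M f < \<infinity>"
  unfolding L2_def energy_def by (auto simp: integrable_iff_bounded)

lemma L2_measurable: "f \<in> L2 M \<Longrightarrow> f \<in> borel_measurable M"
  by (simp add: L2_def)

lemma energy_eq_norm: "f \<in> L2 M \<Longrightarrow> ennreal ((norm_L2 M f)\<^sup>2) = energy M f"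
  unfolding energy_def norm_L2_def L2_def by (auto simp: nn_integral_eq_integral)

lemma ennreal_mult_norm: "f \<in> L2 M \<Longrightarrow> ennreal (B * (norm_L2 M f)\<^sup>2) = ennreal B * energy M f"
  by (simp add: ennreal_mult'' energy_eq_norm)

lemma upper_bound_iff: "upper_bound M I e B \<longleftrightarrow> (\<forall>f\<in>L2 M. coeff_sum M I e f \<le> ennreal B * energy M f)"
  by (simp add: upper_bound_def ennreal_mult_norm)

lemma lower_bound_iff: "lower_bound M I e A \<longleftrightarrow> (\<forall>f\<in>L2 M. ennreal A * energy M f \<le> coeff_sum M I e f)"
  by (simp add: lower_bound_def ennreal_mult_norm)

text \<open>Cauchy-Schwarz, localized: only the part of \<open>h\<close> on the support of
  \<open>f\<close> enters, which later turns coefficient sums into overlap counts. If the product is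
  not integrable, its Bochner integral is 0 by convention.\<close>

lemma coeff_le_energy:
  assumes [measurable]: "f \<in> borel_measurable M" "h \<in> borel_measurable M" "E \<in> sets M"
    and "\<And>x. x \<notin> E \<Longrightarrow> f x = 0"
  shows "coeff M f h \<le> energy M f * (\<integral>\<^sup>+x. indicator E x * ennreal ((cmod (h x))\<^sup>2) \<partial>M)"
proof (cases "integrable M (\<lambda>x. f x * cnj (h x))")
  case True
  have "ennreal (cmod (inner_L2 M f h)) \<le> (\<integral>\<^sup>+x. ennreal (cmod (f x * cnj (h x))) \<partial>M)"
    unfolding inner_L2_def by (rule integral_norm_bound_ennreal[OF True])
  also have "\<dots> = (\<integral>\<^sup>+x. ennreal (cmod (f x)) * (indicator E x * ennreal (cmod (h x))) \<partial>M)"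
    using assms(4) by (intro nn_integral_cong) (auto simp: norm_mult ennreal_mult indicator_def)
  finally have "(ennreal (cmod (inner_L2 M f h)))\<^sup>2 \<le> (\<integral>\<^sup>+x. ennreal (cmod (f x)) * (indicator E x * ennreal (cmod (h x))) \<partial>M)\<^sup>2"
    by (intro power_mono) auto
  also have "\<dots> \<le> (\<integral>\<^sup>+x. (ennreal (cmod (f x)))\<^sup>2 \<partial>M) * (\<integral>\<^sup>+x. (indicator E x * ennreal (cmod (h x)))\<^sup>2 \<partial>M)"
    by (rule Cauchy_Schwarz_nn_integral) auto
  also have "\<dots> = energy M f * (\<integral>\<^sup>+x. indicator E x * ennreal ((cmod (h x))\<^sup>2) \<partial>M)"
    unfolding energy_def
    by (intro arg_cong2[where f = "(*)"] nn_integral_cong) (auto simp: ennreal_power indicator_def)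
  finally show ?thesis by (simp add: coeff_def ennreal_power)
qed (simp add: coeff_def inner_L2_def not_integrable_integral_eq)

lemma L2_mult_integrable:
  assumes "f \<in> L2 M" "h \<in> L2 M"
  shows "integrable M (\<lambda>x. f x * cnj (h x))"
proof (rule Bochner_Integration.integrable_bound)
  show "integrable M (\<lambda>x. (cmod (f x))\<^sup>2 + (cmod (h x))\<^sup>2)" using assms by (simp add: L2_def)
  show "(\<lambda>x. f x * cnj (h x)) \<in> borel_measurable M" using assms[THEN L2_measurable] by measurable
  have "cmod (f x) * cmod (h x) \<le> (cmod (f x))\<^sup>2 + (cmod (h x))\<^sup>2" for x
  proof -
    have "0 \<le> cmod (f x) * cmod (h x)" by simp
    then show ?thesis using sum_squares_bound[of "cmod (f x)" "cmod (h x)"] by linarith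
  qed
  then show "AE x in M. norm (f x * cnj (h x)) \<le> norm ((cmod (f x))\<^sup>2 + (cmod (h x))\<^sup>2)"
    by (simp add: norm_mult)
qed

lemma L2_diff:
  assumes "f \<in> L2 M" "h \<in> L2 M" shows "(\<lambda>x. f x - h x) \<in> L2 M"
proof -
  have "integrable M (\<lambda>x. (cmod (f x - h x))\<^sup>2)"
  proof (rule Bochner_Integration.integrable_bound)
    show "integrable M (\<lambda>x. 2 * (cmod (f x))\<^sup>2 + 2 * (cmod (h x))\<^sup>2)" using assms by (simp add: L2_def)
    show "(\<lambda>x. (cmod (f x - h x))\<^sup>2) \<in> borel_measurable M" using assms[THEN L2_measurable] by measurable
    have "(cmod (f x - h x))\<^sup>2 \<le> 2 * (cmod (f x))\<^sup>2 + 2 * (cmod (h x))\<^sup>2" for x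
    proof -
      have "(cmod (f x - h x))\<^sup>2 \<le> (cmod (f x) + cmod (h x))\<^sup>2"
        by (intro power_mono norm_triangle_ineq4) auto
      also have "\<dots> \<le> 2 * (cmod (f x))\<^sup>2 + 2 * (cmod (h x))\<^sup>2"
        using sum_squares_bound[of "cmod (f x)" "cmod (h x)"] by (simp add: power2_sum)
      finally show ?thesis .
    qed
    then show "AE x in M. norm ((cmod (f x - h x))\<^sup>2) \<le> norm (2 * (cmod (f x))\<^sup>2 + 2 * (cmod (h x))\<^sup>2)"
      by simp
  qed
  then show ?thesis using assms by (auto simp: L2_def)
qed

text \<open>A weighted triangle inequality: the factor of the main term can be brought as close to 1
  as desired at the expense of the error term, so exact bounds survive truncation.\<close>

lemma coeff_diff_le:
  assumes "f \<in> L2 M" "f' \<in> L2 M" "h \<in> L2 M" "t > 0"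
  shows "coeff M f' h \<le> ennreal (1 + t) * coeff M f h + ennreal (1 + 1 / t) * coeff M (\<lambda>x. f x - f' x) h"
proof -
  define a b where "a = inner_L2 M f h" and "b = inner_L2 M (\<lambda>x. f x - f' x) h"
  have "b = (LINT x|M. f x * cnj (h x) - f' x * cnj (h x))"
    by (simp add: b_def inner_L2_def left_diff_distrib)
  also have "\<dots> = a - inner_L2 M f' h" unfolding a_def inner_L2_def
    using assms by (intro Bochner_Integration.integral_diff L2_mult_integrable)
  finally have "inner_L2 M f' h = a - b" by simp
  then have "(cmod (inner_L2 M f' h))\<^sup>2 \<le> (cmod a + cmod b)\<^sup>2"
    by (simp add: norm_triangle_ineq4)
  also have "\<dots> \<le> (1 + t) * (cmod a)\<^sup>2 + (1 + 1 / t) * (cmod b)\<^sup>2"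
  proof -
    \<comment> \<open>This quotient is exactly the gap between the two sides.\<close>
    have "0 \<le> (t * cmod a - cmod b)\<^sup>2 / t" using assms(4) by simp
    also have "\<dots> = t * (cmod a)\<^sup>2 + (cmod b)\<^sup>2 / t - 2 * cmod a * cmod b"
      using assms(4) by (simp add: field_simps power2_eq_square)
    finally show ?thesis by (simp add: power2_sum algebra_simps)
  qed
  finally have "coeff M f' h \<le> ennreal ((1 + t) * (cmod a)\<^sup>2 + (1 + 1 / t) * (cmod b)\<^sup>2)"
    unfolding coeff_def by (rule ennreal_leI)
  also have "\<dots> = ennreal (1 + t) * coeff M f h + ennreal (1 + 1 / t) * coeff M (\<lambda>x. f x - f' x) h"
    using assms(4) by (simp add: coeff_def a_def b_def ennreal_mult ennreal_plus)
  finally show ?thesis .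
qed

lemma coeff_scale:
  "coeff M f (\<lambda>x. of_real r * h x) = ennreal (r\<^sup>2) * coeff M f h"
proof -
  have "inner_L2 M f (\<lambda>x. of_real r * h x) = of_real r * inner_L2 M f h"
    unfolding inner_L2_def by (simp add: mult.left_commute)
  then show ?thesis by (simp add: coeff_def norm_mult power_mult_distrib ennreal_mult)
qed

context normalized_local_field
begin

section \<open>Action of translations and dilations on integrals and coefficients\<close>

lemma measurable_affine [measurable]: "(\<lambda>x. a * x + b) \<in> measurable borel (borel :: 'k measure)"
  by (intro borel_measurable_continuous_onI continuous_on_affine_map)

lemma measurable_mult_const [measurable]: "(\<lambda>x. a * x) \<in> measurable borel (borel :: 'k measure)"
  using measurable_affine[of a 0] by simp

lemma measurable_plus_const [measurable]: "(\<lambda>x. x + a) \<in> measurable borel (borel :: 'k measure)"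
  and measurable_minus_const [measurable]: "(\<lambda>x. x - a) \<in> measurable borel (borel :: 'k measure)"
  using measurable_affine[of 1 a] measurable_affine[of 1 "-a"] by simp_all

lemma q_nonzero [simp]: "q \<noteq> 0"
  using q_pos by simp

lemma measurable_M: "borel_measurable M = borel_measurable borel"
  by (intro measurable_cong_sets) auto

lemma distr_plus: "distr M M (\<lambda>x. x + a) = M"
proof (rule measure_eqI)
  fix S assume "S \<in> sets (distr M M (\<lambda>x. x + a))"
  then have S: "S \<in> sets borel" by simp
  have m: "(\<lambda>x. x + a) \<in> measurable M M" by simp
  have "(\<lambda>x. x + a) -` S = (+) (-a) ` S" by (simp only: translation_image_eq_vimage) simp
  then have "emeasure (distr M M (\<lambda>x. x + a)) S = emeasure M ((+) (-a) ` S)"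
    using S m by (simp only: emeasure_distr sets_M) simp
  then show "emeasure (distr M M (\<lambda>x. x + a)) S = emeasure M S"
    using emeasure_translation[OF S] by metis
qed simp

lemma distr_mult:
  assumes "a \<noteq> 0"
  shows "distr M M (\<lambda>x. a * x) = density M (\<lambda>_. ennreal (1 / v a))"
proof (rule measure_eqI)
  fix S assume "S \<in> sets (distr M M (\<lambda>x. a * x))"
  then have S: "S \<in> sets borel" by simp
  have m: "(\<lambda>x. a * x) \<in> measurable M M" by simp
  have "(\<lambda>x. a * x) -` S = (*) (inverse a) ` S"
    using mult_image_eq_vimage[of "inverse a" S] assms by simp
  then show "emeasure (distr M M (\<lambda>x. a * x)) S = emeasure (density M (\<lambda>_. ennreal (1 / v a))) S"
    using S m assms by (simp add: emeasure_distr emeasure_mult emeasure_density nn_integral_cmult v_inverse divide_inverse)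
qed simp

lemma nn_integral_plus:
  assumes "f \<in> borel_measurable M" shows "(\<integral>\<^sup>+x. f (x + a) \<partial>M) = (\<integral>\<^sup>+x. f x \<partial>M)"
  using nn_integral_distr[of "\<lambda>x. x + a" M M f] assms by (simp add: distr_plus)

lemma nn_integral_mult:
  assumes "f \<in> borel_measurable M" "a \<noteq> 0"
  shows "(\<integral>\<^sup>+x. f (a * x) \<partial>M) = ennreal (1 / v a) * (\<integral>\<^sup>+x. f x \<partial>M)"
  using nn_integral_distr[of "\<lambda>x. a * x" M M f] assms
  by (simp add: distr_mult nn_integral_density nn_integral_cmult)

lemma integral_plus:
  fixes f :: "'k \<Rightarrow> complex"
  assumes "f \<in> borel_measurable M" shows "(LINT x|M. f (x + a)) = (LINT x|M. f x)"
  using integral_distr[of "\<lambda>x. x + a" M M f] assms by (simp add: distr_plus)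

lemma integral_mult:
  fixes f :: "'k \<Rightarrow> complex"
  assumes "f \<in> borel_measurable M" "a \<noteq> 0"
  shows "(LINT x|M. f (a * x)) = of_real (1 / v a) * (LINT x|M. f x)"
proof -
  have "(LINT x|M. f (a * x)) = (LINT x|density M (\<lambda>_. ennreal (1 / v a)). f x)"
    using integral_distr[of "\<lambda>x. a * x" M M f] assms by (simp add: distr_mult)
  also have "\<dots> = (LINT x|M. (1 / v a) *\<^sub>R f x)" using assms by (intro integral_density) auto
  also have "\<dots> = (1 / v a) *\<^sub>R (LINT x|M. f x)" by (rule integral_scaleR_right)
  finally show ?thesis by (simp add: scaleR_conv_of_real)
qed

abbreviation "\<delta> \<equiv> dilate q \<pi>"

lemma measurable_translate [measurable]: "f \<in> borel_measurable M \<Longrightarrow> translate y f \<in> borel_measurable M"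
  unfolding translate_def measurable_M by (rule measurable_compose[OF measurable_minus_const])

lemma measurable_dilate [measurable]: "f \<in> borel_measurable M \<Longrightarrow> \<delta> j f \<in> borel_measurable M"
  unfolding dilate_def measurable_M
  by (intro borel_measurable_times borel_measurable_const measurable_compose[OF measurable_mult_const])

lemma powr_half_square: "(real q powr (real_of_int j / 2))\<^sup>2 = real q powi j"
proof -
  have "(real q powr (real_of_int j / 2))\<^sup>2 = real q powr real_of_int j"
    by (simp add: power2_eq_square flip: powr_add)
  then show ?thesis using powr_real_of_int'[of "real q" j] q_real_pos by simp
qed

lemma energy_translate: "f \<in> borel_measurable M \<Longrightarrow> energy M (translate y f) = energy M f"
  unfolding energy_def translate_def using nn_integral_plus[of "\<lambda>x. ennreal ((cmod (f x))\<^sup>2)" "-y"] by simp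

lemma energy_dilate:
  assumes [measurable]: "f \<in> borel_measurable M" shows "energy M (\<delta> j f) = energy M f"
proof -
  have "energy M (\<delta> j f) = (\<integral>\<^sup>+x. ennreal (real q powi j) * ennreal ((cmod (f (\<pi> powi (-j) * x)))\<^sup>2) \<partial>M)"
    unfolding energy_def dilate_def
    by (intro nn_integral_cong) (simp add: norm_mult power_mult_distrib powr_half_square ennreal_mult)
  also have "\<dots> = ennreal (real q powi j) * (\<integral>\<^sup>+x. ennreal ((cmod (f (\<pi> powi (-j) * x)))\<^sup>2) \<partial>M)"
    using measurable_M by (intro nn_integral_cmult) measurable
  also have "\<dots> = ennreal (real q powi j) * (ennreal (1 / real q powi j) * energy M f)"
    using nn_integral_mult[of "\<lambda>x. ennreal ((cmod (f x))\<^sup>2)" "\<pi> powi (-j)"]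
    by (simp add: energy_def v_pi_powi)
  also have "\<dots> = energy M f"
    using q_real_pos by (simp flip: mult.assoc ennreal_mult)
  finally show ?thesis .
qed

lemma L2_translate: "f \<in> L2 M \<Longrightarrow> translate y f \<in> L2 M"
  by (simp add: L2_iff energy_translate measurable_translate)

lemma L2_dilate: "f \<in> L2 M \<Longrightarrow> \<delta> j f \<in> L2 M"
  by (simp add: L2_iff energy_dilate measurable_dilate)

lemma inner_translate:
  assumes [measurable]: "f \<in> borel_measurable M" "h \<in> borel_measurable M"
  shows "inner_L2 M (translate y f) (translate y h) = inner_L2 M f h"
  unfolding inner_L2_def translate_def using integral_plus[of "\<lambda>x. f x * cnj (h x)" "-y"] by (simp add: borel_measurable_cnj)

lemma inner_dilate:
  assumes [measurable]: "f \<in> borel_measurable M" "h \<in> borel_measurable M"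
  shows "inner_L2 M (\<delta> j f) (\<delta> j h) = inner_L2 M f h"
proof -
  let ?r = "real q powr (real_of_int j / 2)"
  have "inner_L2 M (\<delta> j f) (\<delta> j h) = (LINT x|M. of_real (real q powi j) * (f (\<pi> powi (-j) * x) * cnj (h (\<pi> powi (-j) * x))))"
    unfolding inner_L2_def dilate_def
    by (simp add: powr_half_square[symmetric] power2_eq_square mult_ac)
  also have "\<dots> = of_real (real q powi j) * (of_real (1 / real q powi j) * inner_L2 M f h)"
    using integral_mult[of "\<lambda>x. f x * cnj (h x)" "\<pi> powi (-j)"]
    by (simp add: inner_L2_def v_pi_powi)
  also have "\<dots> = inner_L2 M f h" using q_real_pos by simp
  finally show ?thesis .
qed

lemma coeff_translate:
  "f \<in> borel_measurable M \<Longrightarrow> h \<in> borel_measurable M \<Longrightarrow> coeff M (translate y f) (translate y h) = coeff M f h"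
  by (simp add: coeff_def inner_translate)

lemma coeff_dilate:
  "f \<in> borel_measurable M \<Longrightarrow> h \<in> borel_measurable M \<Longrightarrow> coeff M (\<delta> j f) (\<delta> j h) = coeff M f h"
  by (simp add: coeff_def inner_dilate)

lemma translate_translate: "translate y (translate z f) = translate (y + z) f"
  by (auto simp: translate_def diff_diff_eq)

lemma translate_0 [simp]: "translate 0 f = f"
  by (simp add: translate_def)

lemma dilate_0 [simp]: "\<delta> 0 f = f"
  using q_real_pos by (simp add: dilate_def)

lemma dilate_dilate: "\<delta> i (\<delta> j f) = \<delta> (i + j) f"
proof
  fix x
  have "real q powr (real_of_int i / 2) * real q powr (real_of_int j / 2) = real q powr (real_of_int (i + j) / 2)"
    by (simp add: add_divide_distrib flip: powr_add)
  moreover have "\<pi> powi (- j) * (\<pi> powi (- i) * x) = \<pi> powi (- (i + j)) * x"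
    by (simp add: mult.assoc[symmetric] power_int_add[symmetric] add.commute)
  ultimately show "\<delta> i (\<delta> j f) x = \<delta> (i + j) f x"
    unfolding dilate_def by (simp only: mult.assoc[symmetric] flip: of_real_mult)
qed

lemma dilate_translate: "\<delta> j (translate y f) = translate (\<pi> powi j * y) (\<delta> j f)"
proof
  fix x
  have "\<pi> powi (- j) * (x - \<pi> powi j * y) = \<pi> powi (- j) * x - y"
    by (simp add: right_diff_distrib mult.assoc[symmetric] power_int_add[symmetric])
  then show "\<delta> j (translate y f) x = translate (\<pi> powi j * y) (\<delta> j f) x"
    by (simp add: dilate_def translate_def)
qed

section \<open>Single levels of the two systems\<close>

definition affine_level :: "int \<Rightarrow> ('k \<Rightarrow> complex) \<Rightarrow> ('k \<Rightarrow> complex) \<Rightarrow> ennreal" where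
  "affine_level j g f = (\<Sum>k. coeff M f (\<delta> j (translate (\<u> k) g)))"

text \<open>For \<open>j < 0\<close> the square of the amplitude \<open>q powr (j / 2)\<close> is
  pulled out of the coefficients, and the shifts run over \<Lambda> itself instead of its image
  under \<open>\<pi> powi j\<close>.\<close>

definition quasi_level :: "int \<Rightarrow> ('k \<Rightarrow> complex) \<Rightarrow> ('k \<Rightarrow> complex) \<Rightarrow> ennreal" where
  "quasi_level j g f = (if 0 \<le> j then affine_level j g f
     else ennreal (real q powi j) * (\<Sum>k. coeff M f (translate (\<u> k) (\<delta> j g))))"

lemma affine_level_dilate:
  assumes "f \<in> borel_measurable M" "g \<in> borel_measurable M"
  shows "affine_level j g (\<delta> m f) = affine_level (j - m) g f"
proof -
  have "coeff M (\<delta> m f) (\<delta> j (translate (\<u> k) g)) = coeff M f (\<delta> (j - m) (translate (\<u> k) g))" for k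
    using coeff_dilate[of f "\<delta> (j - m) (translate (\<u> k) g)" m] assms
    by (simp add: dilate_dilate measurable_dilate measurable_translate)
  then show ?thesis by (simp add: affine_level_def)
qed

text \<open>Translating \<open>f\<close> back amounts to moving the generator forward. The shifts
  fill the coset of \<open>y\<close> modulo the dilated lattice, so averaging over \<open>y\<close>
  is averaging over cosets.\<close>

lemma affine_level_translate:
  assumes "f \<in> borel_measurable M" "g \<in> borel_measurable M"
  shows "affine_level j g (translate (- y) f) = (\<Sum>k. coeff M f (translate (y + \<pi> powi j * \<u> k) (\<delta> j g)))"
proof -
  have "coeff M (translate (- y) f) (\<delta> j (translate (\<u> k) g)) = coeff M f (translate (y + \<pi> powi j * \<u> k) (\<delta> j g))" for k
    using coeff_translate[of f "translate (y + \<pi> powi j * \<u> k) (\<delta> j g)" "-y"] assms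
    by (simp add: dilate_translate translate_translate measurable_dilate measurable_translate)
  then show ?thesis by (simp add: affine_level_def)
qed

text \<open>For \<open>j < 0\<close> the quasi-affine shifts form the full lattice of all \<open>u k\<close>, while the affine
  ones form its sublattice of index \<open>q ^ (- j)\<close>; the first \<open>q ^ J\<close> lattice points meet each of its
  cosets equally often.\<close>

lemma quasi_level_average:
  assumes f: "f \<in> borel_measurable M" and g: "g \<in> borel_measurable M" and j: "- int J \<le> j"
  shows "(\<Sum>n<q ^ J. affine_level j g (translate (- \<u> n) f)) = of_nat (q ^ J) * quasi_level j g f"
proof (cases "0 \<le> j")
  case True
  then obtain i where i: "j = int i" using nonneg_int_cases by blast
  have "affine_level j g (translate (- \<u> n) f) = affine_level j g f" for n
  proof -
    \<comment> \<open>For \<open>j \<ge> 0\<close> the dilated lattice contains \<Lambda> and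
      absorbs the translation, so all terms of the average agree.\<close>
    have "\<u> n + \<pi> powi j * \<u> k = \<pi> powi j * (\<u> k + \<u> (q ^ i * n))" for k
      unfolding u_mult_pow i by (simp add: algebra_simps power_inverse)
    then have "affine_level j g (translate (- \<u> n) f)
        = (\<Sum>k. coeff M f (translate (\<pi> powi j * (\<u> k + \<u> (q ^ i * n))) (\<delta> j g)))"
      using f g by (simp add: affine_level_translate)
    also have "\<dots> = (\<Sum>k. coeff M f (translate (\<pi> powi j * \<u> k) (\<delta> j g)))"
      by (rule suminf_u_shift)
    finally show ?thesis by (simp add: affine_level_def dilate_translate)
  qed
  then show ?thesis using True by (simp add: quasi_level_def)
next
  case False
  define m where "m = nat (- j)"
  have m: "j = - int m" "m \<le> J" using False j by (auto simp: m_def)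
  have pij: "\<pi> powi j = inverse \<pi> ^ m" by (simp add: m power_int_minus power_inverse)
  define H where "H = (\<lambda>y. coeff M f (translate y (\<delta> j g)))"
  have lev: "affine_level j g (translate (- \<u> n) f) = (\<Sum>k. H (\<u> n + inverse \<pi> ^ m * \<u> k))" for n
    using f g by (simp add: affine_level_translate H_def pij)
  \<comment> \<open>The block number \<open>l\<close> moves the point only within the sublattice, so
    the level depends on the residue \<open>i\<close> alone.\<close>
  have red: "(\<Sum>k. H (\<u> (i + q ^ m * l) + inverse \<pi> ^ m * \<u> k)) = (\<Sum>k. H (\<u> (i + q ^ m * k)))"
    if "i < q ^ m" for i l
  proof -
    have "(\<Sum>k. H (\<u> (i + q ^ m * l) + inverse \<pi> ^ m * \<u> k))
        = (\<Sum>k. H (\<u> i + inverse \<pi> ^ m * (\<u> k + \<u> l)))"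
      unfolding u_shift[OF that] by (simp add: algebra_simps)
    also have "\<dots> = (\<Sum>k. H (\<u> i + inverse \<pi> ^ m * \<u> k))"
      by (rule suminf_u_shift)
    finally show ?thesis using that by (simp add: u_shift)
  qed
  have "(\<Sum>n<q ^ J. affine_level j g (translate (- \<u> n) f))
      = (\<Sum>l<q ^ (J - m). \<Sum>i<q ^ m. affine_level j g (translate (- \<u> (i + q ^ m * l)) f))"
    using sum_mult_div[of "q ^ m" "\<lambda>n. affine_level j g (translate (- \<u> n) f)" "q ^ (J - m)"] m
    by (simp flip: power_add)
  also have "\<dots> = (\<Sum>l<q ^ (J - m). \<Sum>i<q ^ m. \<Sum>k. H (\<u> (i + q ^ m * k)))"
    by (intro sum.cong) (auto simp: lev red)
  also have "\<dots> = (\<Sum>l<q ^ (J - m). \<Sum>k. H (\<u> k))"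
    using suminf_ennreal_group[of "q ^ m" "\<lambda>k. H (\<u> k)"] by simp
  also have "\<dots> = of_nat (q ^ (J - m)) * (\<Sum>k. H (\<u> k))" by simp
  also have "(of_nat (q ^ (J - m)) :: ennreal) = of_nat (q ^ J) * ennreal (real q powi j)"
  proof -
    have "real (q ^ (J - m)) = real (q ^ J) * real q powi j"
    proof -
      have "real q ^ J = real q ^ (J - m) * real q ^ m" using m(2) by (simp flip: power_add)
      then show ?thesis using q_real_pos unfolding m(1) by (simp add: power_int_minus)
    qed
    then show ?thesis
      by (simp only: ennreal_of_nat_eq_real_of_nat) (simp add: ennreal_mult)
  qed
  finally show ?thesis using False by (simp add: quasi_level_def H_def mult.assoc)
qed

text \<open>Undoing the translations moves them from \<open>h\<close> to the set \<open>E\<close>.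
  The whole lattice sum is then governed by how often the points of \<open>x + \<Lambda>\<close> hit
  \<open>E\<close>.\<close>

lemma lattice_coeff_le:
  assumes [measurable]: "f \<in> borel_measurable M" "h \<in> borel_measurable M" "E \<in> sets borel"
    and supp: "\<And>x. x \<notin> E \<Longrightarrow> f x = 0"
  shows "(\<Sum>k. coeff M f (translate (\<u> k) h))
     \<le> energy M f * (\<integral>\<^sup>+x. (\<Sum>k. indicator E (x + \<u> k)) * ennreal ((cmod (h x))\<^sup>2) \<partial>M)"
proof -
  have m: "(\<lambda>x. indicator E (x + \<u> k) * ennreal ((cmod (h x))\<^sup>2)) \<in> borel_measurable M" for k
    using assms(2) unfolding measurable_M by measurable
  have "coeff M f (translate (\<u> k) h) \<le> energy M f * (\<integral>\<^sup>+x. indicator E (x + \<u> k) * ennreal ((cmod (h x))\<^sup>2) \<partial>M)" for k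
  proof -
    have "coeff M f (translate (\<u> k) h) \<le> energy M f * (\<integral>\<^sup>+x. indicator E x * ennreal ((cmod (translate (\<u> k) h x))\<^sup>2) \<partial>M)"
      using supp by (intro coeff_le_energy) auto
    also have "(\<integral>\<^sup>+x. indicator E x * ennreal ((cmod (translate (\<u> k) h x))\<^sup>2) \<partial>M)
        = (\<integral>\<^sup>+x. indicator E (x + \<u> k) * ennreal ((cmod (h x))\<^sup>2) \<partial>M)"
      using nn_integral_plus[of "\<lambda>x. indicator E x * ennreal ((cmod (translate (\<u> k) h x))\<^sup>2)" "\<u> k"]
      by (simp add: translate_def[of _ h])
    finally show ?thesis .
  qed
  then have "(\<Sum>k. coeff M f (translate (\<u> k) h))
      \<le> (\<Sum>k. energy M f * (\<integral>\<^sup>+x. indicator E (x + \<u> k) * ennreal ((cmod (h x))\<^sup>2) \<partial>M))"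
    by (intro suminf_le) auto
  also have "\<dots> = energy M f * (\<integral>\<^sup>+x. (\<Sum>k. indicator E (x + \<u> k) * ennreal ((cmod (h x))\<^sup>2)) \<partial>M)"
    by (simp only: ennreal_suminf_cmult nn_integral_suminf[OF m])
  finally show ?thesis by simp
qed

text \<open>Integer exponents, because growing discs occur in truncation and shrinking ones after
  dilation.\<close>

definition disc :: "int \<Rightarrow> 'k set" where
  "disc s = {x. v x \<le> real q powi s}"

lemma disc_borel [measurable]: "disc s \<in> sets borel"
proof -
  have "disc s = (\<lambda>x. \<pi> powi s * x) -` \<O>"
    using q_real_pos by (auto simp: disc_def integer_ring_def v_mult v_pi_powi power_int_minus field_simps)
  then show ?thesis using measurable_sets_borel[OF measurable_mult_const O_borel] by metis
qed

end

section \<open>Overlap of dilated supports\<close>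

text \<open>Dividing by \<open>q ^ k\<close> and letting \<open>k\<close> grow removes an error that
  does not depend on \<open>k\<close>.\<close>

lemma ennreal_le_of_power_scaled:
  fixes X Y :: ennreal
  assumes "q \<ge> 2" "\<And>k. of_nat (q ^ k) * X \<le> of_nat (q ^ k) * Y + ennreal d"
  shows "X \<le> Y"
proof (rule ennreal_le_epsilon)
  fix e :: real assume "e > 0"
  obtain k where "(1 / real q) ^ k < e / (\<bar>d\<bar> + 1)"
    using real_arch_pow_inv[of "e / (\<bar>d\<bar> + 1)" "1 / real q"] assms(1) \<open>e > 0\<close> by auto
  then have k: "\<bar>d\<bar> + 1 < e * real q ^ k"
    using assms(1) by (simp add: field_simps power_one_over)
  have "of_nat (q ^ k) * X \<le> of_nat (q ^ k) * Y + ennreal (real (q ^ k) * e)"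
    by (rule order_trans[OF assms(2)[of k]], intro add_mono ennreal_leI) (use k in \<open>auto simp: mult.commute\<close>)
  also have "\<dots> = of_nat (q ^ k) * (Y + ennreal e)"
    using \<open>e > 0\<close> by (simp add: distrib_left ennreal_mult ennreal_of_nat_eq_real_of_nat)
  finally show "X \<le> Y + ennreal e"
    using assms(1) by (subst (asm) ennreal_mult_le_mult_iff) (auto simp del: of_nat_power)
qed

lemma suminf_indicator_le:
  assumes "finite A" "card A \<le> N"
  shows "(\<Sum>k. indicator A k :: ennreal) \<le> of_nat N"
proof -
  have "(\<Sum>k. indicator A k :: ennreal) = (\<Sum>k\<in>A. indicator A k)"
    using assms(1) by (intro suminf_finite) auto
  also have "\<dots> = of_nat (card A)" by simp
  finally show ?thesis using assms(2) by simp
qed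

context normalized_local_field
begin

text \<open>Subtracting one member \<open>n0\<close> maps the set injectively into the lattice
  points of a disc around 0, whose indices lie below \<open>q ^ s\<close>.\<close>

lemma card_lattice_disc:
  "finite {n. v (z + \<u> n) \<le> real q ^ s} \<and> card {n. v (z + \<u> n) \<le> real q ^ s} \<le> q ^ s"
proof (cases "{n. v (z + \<u> n) \<le> real q ^ s} = {}")
  case False
  let ?A = "{n. v (z + \<u> n) \<le> real q ^ s}"
  obtain n0 where n0: "n0 \<in> ?A" using False by blast
  define i where "i n = (SOME k. \<u> k = \<u> n - \<u> n0)" for n
  have i: "\<u> (i n) = \<u> n - \<u> n0" for n unfolding i_def by (rule someI_ex[OF u_diff])
  have "inj_on i ?A"
  proof (rule inj_onI)
    fix n m assume "i n = i m"
    then have "\<u> n = \<u> m" using i[of n] i[of m] by simp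
    then show "n = m" by (rule injD[OF u_inj])
  qed
  moreover have "i ` ?A \<subseteq> {..<q ^ s}"
  proof
    fix k assume "k \<in> i ` ?A"
    then obtain n where n: "k = i n" "n \<in> ?A" by blast
    have "v ((z + \<u> n) - (z + \<u> n0)) \<le> real q ^ s" using n n0 by (intro v_diff_le) auto
    then have "v (\<u> k) \<le> real q ^ s" by (simp add: n i)
    then show "k \<in> {..<q ^ s}" by (simp add: v_u_le_iff)
  qed
  ultimately show ?thesis
    using card_inj_on_le[of i ?A "{..<q ^ s}"] inj_on_finite[of i ?A "{..<q ^ s}"] by simp
qed simp

lemma lattice_unique:
  assumes "v (x + \<u> k) \<le> 1" "v (x + \<u> k') \<le> 1" shows "k = k'"
proof -
  have "card {n. v (x + \<u> n) \<le> real q ^ 0} \<le> 1" "finite {n. v (x + \<u> n) \<le> real q ^ 0}"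
    using card_lattice_disc[of x 0] by auto
  then show ?thesis using assms by (auto simp: card_le_Suc0_iff_eq)
qed

text \<open>The numbers \<open>q ^ (J + Suc m) * w\<close> grow by the factor \<open>q\<close> with
  each \<open>m\<close>, while the half-open window has ratio \<open>q ^ k\<close>, so at most
  \<open>k\<close> of them fit.\<close>

lemma card_scales:
  fixes w :: real
  assumes "k \<le> J"
  defines "A \<equiv> {m. real q ^ (J - k) < real q ^ (J + Suc m) * w \<and> real q ^ (J + Suc m) * w \<le> real q ^ J}"
  shows "finite A \<and> card A \<le> k"
proof (cases "A = {}")
  case False
  then have ex: "\<exists>m. m \<in> A" by blast
  define m0 where "m0 = (LEAST m. m \<in> A)"
  have m0: "m0 \<in> A" unfolding m0_def by (rule LeastI_ex[OF ex])
  have "A \<subseteq> {m0..<m0 + k}"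
  proof
    fix m assume m: "m \<in> A"
    have le: "m0 \<le> m" unfolding m0_def using m by (rule Least_le)
    have "real q ^ (J - k) * real q ^ (m - m0) < real q ^ (J + Suc m0) * w * real q ^ (m - m0)"
      using m0 q_real_pos unfolding A_def by (intro mult_strict_right_mono) (blast, simp add: q_real_pos)
    also have "\<dots> = real q ^ (J + Suc m0 + (m - m0)) * w" by (simp add: power_add mult_ac)
    also have "J + Suc m0 + (m - m0) = J + Suc m" using le by simp
    also have "real q ^ (J + Suc m) * w \<le> real q ^ J" using m unfolding A_def by blast
    also have "real q ^ J = real q ^ (J - k) * real q ^ k" using assms(1) by (simp flip: power_add)
    finally have "real q ^ (m - m0) < real q ^ k" using q_real_pos by simp
    then have "m - m0 < k" by (rule power_less_imp_less_exp[OF q_real_gt_1])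
    then show "m \<in> {m0..<m0 + k}" using le by auto
  qed
  moreover have "finite {m0..<m0 + k}" by simp
  ultimately show ?thesis using card_mono[of "{m0..<m0 + k}" A] finite_subset[of A "{m0..<m0 + k}"] by simp
qed simp

text \<open>\<open>E n m\<close> contains every \<open>y\<close> at which the dilation by \<open>J + Suc m\<close> of a function
  supported where \<open>v \<le> q ^ s\<close> and translated by \<open>- u n\<close> may be nonzero. For the given \<open>n\<close> such \<open>y\<close>
  has \<open>v y \<le> 1\<close>, so \<open>y = x + u k\<close> determines \<open>k\<close>, and \<open>v y\<close> leaves at most \<open>r\<close> choices for \<open>m\<close>, each of them leaving
  at most \<open>q ^ s\<close> choices for \<open>n\<close>.\<close>

lemma overlap_le:
  assumes J: "r + s \<le> J"
  defines "E n m \<equiv> {y. v (inverse \<pi> ^ (J + Suc m) * y + \<u> n) \<le> real q ^ s}"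
  shows "(\<Sum>n\<in>{q ^ (J - r)..<q ^ J}. \<Sum>m. \<Sum>k. indicator (E n m) (x + \<u> k) :: ennreal) \<le> of_nat (r * q ^ s)"
proof -
  let ?N = "{q ^ (J - r)..<q ^ J}"
  define A where "A y = {m. real q ^ (J - r) < real q ^ (J + Suc m) * v y \<and> real q ^ (J + Suc m) * v y \<le> real q ^ J}" for y
  \<comment> \<open>As \<open>n \<ge> q ^ (J - r)\<close> and \<open>s \<le> J - r\<close>, the
    point \<open>u n\<close> is larger than \<open>q ^ s\<close>. A sum of size at most
    \<open>q ^ s\<close> then forces the other term to have the same size \<open>v (u n)\<close>,
    which lies in the window.\<close>
  have E1: "m \<in> A y" if "n \<in> ?N" "y \<in> E n m" for n m y
  proof -
    have "v (inverse \<pi> ^ (J + Suc m) * y + \<u> n) \<le> real q ^ s" using that by (simp add: E_def)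
    also have "\<dots> \<le> real q ^ (J - r)" using J q_real_gt_1 by (intro power_increasing) auto
    also have *: "\<dots> < v (\<u> n)" using that by (intro v_u_gt) auto
    finally have "v ((inverse \<pi> ^ (J + Suc m) * y + \<u> n) + - \<u> n) = v (- \<u> n)"
      by (intro v_add_eq) simp
    then have "v (inverse \<pi> ^ (J + Suc m) * y) = v (\<u> n)" by simp
    then have eq: "real q ^ (J + Suc m) * v y = v (\<u> n)" by (simp add: v_mult v_inv_pi_power)
    have "v (\<u> n) \<le> real q ^ J" using that by (intro v_u_le) auto
    then show ?thesis unfolding A_def using eq * by (simp del: power_Suc)
  qed
  have Asmall: "v y \<le> 1" if "m \<in> A y" for m y
  proof (rule ccontr)
    assume "\<not> v y \<le> 1"
    then have "real q ^ (J + Suc m) * 1 < real q ^ (J + Suc m) * v y"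
      using q_real_pos by (intro mult_strict_left_mono) auto
    moreover have "real q ^ J \<le> real q ^ (J + Suc m)" using q_real_gt_1 by (intro power_increasing) auto
    moreover have "real q ^ (J + Suc m) * v y \<le> real q ^ J" using that unfolding A_def by blast
    ultimately show False by linarith
  qed
  have inner: "(\<Sum>n\<in>?N. indicator (E n m) y :: ennreal) \<le> of_nat (q ^ s) * indicator (A y) m" for m y
  proof (cases "m \<in> A y")
    case True
    let ?S = "{n. v (inverse \<pi> ^ (J + Suc m) * y + \<u> n) \<le> real q ^ s}"
    have "(\<Sum>n\<in>?N. indicator (E n m) y :: ennreal) = of_nat (card (?N \<inter> ?S))"
      by (simp add: E_def indicator_def sum.If_cases Collect_conj_eq)
    also have "\<dots> \<le> of_nat (card ?S)"
      using card_lattice_disc[of "inverse \<pi> ^ (J + Suc m) * y" s] by (intro of_nat_mono card_mono) auto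
    also have "\<dots> \<le> of_nat (q ^ s)"
      using card_lattice_disc[of "inverse \<pi> ^ (J + Suc m) * y" s] by (intro of_nat_mono) auto
    finally show ?thesis using True by simp
  next
    case False
    then have "indicator (E n m) y = (0::ennreal)" if "n \<in> ?N" for n
      using E1[OF that] by (auto simp: indicator_def)
    then show ?thesis by simp
  qed
  have key: "(\<Sum>m. \<Sum>k. indicator (A (x + \<u> k)) m :: ennreal) \<le> of_nat r"
  proof (cases "\<exists>k. v (x + \<u> k) \<le> 1")
    case True
    then obtain k0 where k0: "v (x + \<u> k0) \<le> 1" by blast
    have "(\<Sum>k. indicator (A (x + \<u> k)) m :: ennreal) = (\<Sum>k\<in>{k0}. indicator (A (x + \<u> k)) m)" for m
    proof (rule suminf_finite)
      fix k assume "k \<notin> {k0}"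
      then have "\<not> v (x + \<u> k) \<le> 1" using lattice_unique k0 by blast
      then show "indicator (A (x + \<u> k)) m = (0::ennreal)" using Asmall by (auto simp: indicator_def)
    qed simp
    then have "(\<Sum>m. \<Sum>k. indicator (A (x + \<u> k)) m :: ennreal) = (\<Sum>m. indicator (A (x + \<u> k0)) m)" by simp
    also have "\<dots> \<le> of_nat r"
      using card_scales[of r J "v (x + \<u> k0)"] J unfolding A_def by (intro suminf_indicator_le) auto
    finally show ?thesis .
  next
    case False
    then have "indicator (A (x + \<u> k)) m = (0::ennreal)" for k m using Asmall by (auto simp: indicator_def)
    then show ?thesis by simp
  qed
  have "(\<Sum>n\<in>?N. \<Sum>m. \<Sum>k. indicator (E n m) (x + \<u> k) :: ennreal)
      = (\<Sum>m. \<Sum>k. \<Sum>n\<in>?N. indicator (E n m) (x + \<u> k))"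
    by (simp add: suminf_sum)
  also have "\<dots> \<le> (\<Sum>m. \<Sum>k. of_nat (q ^ s) * indicator (A (x + \<u> k)) m)"
    by (intro suminf_le inner) auto
  also have "\<dots> = of_nat (q ^ s) * (\<Sum>m. \<Sum>k. indicator (A (x + \<u> k)) m)"
    by simp
  also have "\<dots> \<le> of_nat (q ^ s) * of_nat r" by (rule mult_left_mono[OF key]) simp
  finally show ?thesis by (simp add: mult.commute)
qed

end

section \<open>Upper bounds\<close>

locale wavelet_family = normalized_local_field +
  fixes L :: nat and \<psi> :: "nat \<Rightarrow> 'a \<Rightarrow> complex"
  assumes psi_L2: "\<And>l. l \<in> {1..L} \<Longrightarrow> \<psi> l \<in> L2 M"
begin

definition affine_total :: "int \<Rightarrow> ('a \<Rightarrow> complex) \<Rightarrow> ennreal" where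
  "affine_total j f = (\<Sum>l\<in>{1..L}. affine_level j (\<psi> l) f)"

definition quasi_total :: "int \<Rightarrow> ('a \<Rightarrow> complex) \<Rightarrow> ennreal" where
  "quasi_total j f = (\<Sum>l\<in>{1..L}. quasi_level j (\<psi> l) f)"

definition affine_sum :: "('a \<Rightarrow> complex) \<Rightarrow> ennreal" where
  "affine_sum f = (\<integral>\<^sup>+j. affine_total j f \<partial>count_space UNIV)"

definition quasi_sum :: "('a \<Rightarrow> complex) \<Rightarrow> ennreal" where
  "quasi_sum f = (\<integral>\<^sup>+j. quasi_total j f \<partial>count_space UNIV)"

abbreviation "index \<equiv> {1..L} \<times> (UNIV :: int set) \<times> (UNIV :: nat set)"

text \<open>The level is put outermost, since the systems are compared after cutting the sum at a
  level.\<close>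

lemma coeff_sum_conv:
  "coeff_sum M index e f = (\<integral>\<^sup>+j. (\<Sum>l\<in>{1..L}. \<Sum>k. coeff M f (e (l, j, k))) \<partial>count_space UNIV)"
proof -
  have "coeff_sum M index e f = (\<integral>\<^sup>+i. coeff M f (e i) \<partial>count_space index)"
    unfolding coeff_sum_def coeff_def
    by (intro infsum_ennreal_conv_nn_integral countable_SIGMA) auto
  also have "\<dots> = (\<integral>\<^sup>+i. coeff M f (e i) \<partial>count_space ({1..L} \<times> UNIV))"
    by simp
  also have "\<dots> = (\<integral>\<^sup>+l. \<integral>\<^sup>+z. coeff M f (e (l, z)) \<partial>count_space UNIV \<partial>count_space {1..L})"
    by (rule nn_integral_count_space_Times)
  also have "\<dots> = (\<Sum>l\<in>{1..L}. \<integral>\<^sup>+z. coeff M f (e (l, z)) \<partial>count_space UNIV)"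
    by (simp add: nn_integral_count_space_finite)
  also have "\<dots> = (\<Sum>l\<in>{1..L}. \<integral>\<^sup>+j. (\<Sum>k. coeff M f (e (l, j, k))) \<partial>count_space UNIV)"
    by (simp add: nn_integral_fst_count_space[symmetric] nn_integral_count_space_nat)
  finally show ?thesis by (simp add: nn_integral_sum)
qed

lemma coeff_sum_affine: "coeff_sum M index (affine_system p c \<pi> \<epsilon> \<psi>) f = affine_sum f"
  unfolding coeff_sum_conv affine_sum_def affine_total_def affine_level_def affine_system_def
  by (simp flip: q_def)

lemma coeff_sum_quasi: "coeff_sum M index (quasi_affine_system p c \<pi> \<epsilon> \<psi>) f = quasi_sum f"
proof -
  have "(\<Sum>k. coeff M f (quasi_affine_system p c \<pi> \<epsilon> \<psi> (l, j, k))) = quasi_level j (\<psi> l) f" for l j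
    unfolding quasi_level_def affine_level_def quasi_affine_system_def q_def[symmetric]
    by (simp add: coeff_scale powr_half_square)
  then show ?thesis unfolding coeff_sum_conv quasi_sum_def quasi_total_def by simp
qed

lemma psi_measurable: "l \<in> {1..L} \<Longrightarrow> \<psi> l \<in> borel_measurable M"
  using psi_L2 L2_measurable by blast

lemma affine_total_dilate:
  "f \<in> borel_measurable M \<Longrightarrow> affine_total j (\<delta> m f) = affine_total (j - m) f"
  unfolding affine_total_def by (intro sum.cong affine_level_dilate psi_measurable) auto

lemma affine_sum_dilate:
  assumes "f \<in> borel_measurable M" shows "affine_sum (\<delta> m f) = affine_sum f"
  unfolding affine_sum_def affine_total_dilate[OF assms]
  using nn_integral_int_shift[of "\<lambda>j. affine_total j f" "- m"] by simp

lemma quasi_total_nonneg: "0 \<le> j \<Longrightarrow> quasi_total j f = affine_total j f"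
  by (simp add: quasi_total_def affine_total_def quasi_level_def)

lemma quasi_total_average:
  assumes "f \<in> borel_measurable M" "- int J \<le> j"
  shows "(\<Sum>n<q ^ J. affine_total j (translate (- \<u> n) f)) = of_nat (q ^ J) * quasi_total j f"
proof -
  have "(\<Sum>n<q ^ J. affine_total j (translate (- \<u> n) f))
      = (\<Sum>l\<in>{1..L}. \<Sum>n<q ^ J. affine_level j (\<psi> l) (translate (- \<u> n) f))"
    unfolding affine_total_def by (rule sum.swap)
  also have "\<dots> = (\<Sum>l\<in>{1..L}. of_nat (q ^ J) * quasi_level j (\<psi> l) f)"
    using assms by (intro sum.cong quasi_level_average psi_measurable) auto
  finally show ?thesis by (simp only: quasi_total_def sum_distrib_left)
qed

text \<open>Below level \<open>- J\<close> the \<open>q ^ J\<close> translates would be too few to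
  meet all cosets of the dilated lattice, hence the cut.\<close>

lemma quasi_integral_average:
  assumes "f \<in> borel_measurable M"
  shows "(\<Sum>n<q ^ J. \<integral>\<^sup>+j. affine_total j (translate (- \<u> n) f) * indicator {- int J..} j \<partial>count_space UNIV)
    = of_nat (q ^ J) * (\<integral>\<^sup>+j. quasi_total j f * indicator {- int J..} j \<partial>count_space UNIV)"
proof -
  have "(\<Sum>n<q ^ J. \<integral>\<^sup>+j. affine_total j (translate (- \<u> n) f) * indicator {- int J..} j \<partial>count_space UNIV)
      = (\<integral>\<^sup>+j. (\<Sum>n<q ^ J. affine_total j (translate (- \<u> n) f) * indicator {- int J..} j) \<partial>count_space UNIV)"
    by (rule nn_integral_sum[symmetric]) auto
  also have "\<dots> = (\<integral>\<^sup>+j. of_nat (q ^ J) * (quasi_total j f * indicator {- int J..} j) \<partial>count_space UNIV)"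
  proof (rule nn_integral_cong)
    fix j
    have "(\<Sum>n<q ^ J. affine_total j (translate (- \<u> n) f) * indicator {- int J..} j)
        = (\<Sum>n<q ^ J. affine_total j (translate (- \<u> n) f)) * indicator {- int J..} j"
      by (simp only: sum_distrib_right)
    also have "\<dots> = of_nat (q ^ J) * (quasi_total j f * indicator {- int J..} j)"
    proof (cases "- int J \<le> j")
      case True
      then show ?thesis by (simp only: quasi_total_average[OF assms True] mult.assoc)
    qed simp
    finally show "(\<Sum>n<q ^ J. affine_total j (translate (- \<u> n) f) * indicator {- int J..} j)
      = of_nat (q ^ J) * (quasi_total j f * indicator {- int J..} j)" .
  qed
  also have "\<dots> = of_nat (q ^ J) * (\<integral>\<^sup>+j. quasi_total j f * indicator {- int J..} j \<partial>count_space UNIV)"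
    by (rule nn_integral_cmult) simp
  finally show ?thesis .
qed

lemma q_power_ennreal: "(of_nat (q ^ J) :: ennreal) \<noteq> 0" "(of_nat (q ^ J) :: ennreal) \<noteq> top"
  by (simp_all del: of_nat_power)

text \<open>For an upper bound the levels \<open>j < - J\<close> may be added on the affine side for
  free; all translates have the same energy, so the factor \<open>q ^ J\<close> cancels.\<close>

lemma affine_upper_imp_quasi_upper:
  assumes C: "\<And>f. f \<in> L2 M \<Longrightarrow> affine_sum f \<le> C * energy M f" and f: "f \<in> L2 M"
  shows "quasi_sum f \<le> C * energy M f"
  unfolding quasi_sum_def
proof (rule nn_integral_int_le)
  fix J :: nat
  have fm: "f \<in> borel_measurable M" using f by (rule L2_measurable)
  have "of_nat (q ^ J) * (\<integral>\<^sup>+j. quasi_total j f * indicator {- int J..} j \<partial>count_space UNIV)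
     \<le> (\<Sum>n<q ^ J. affine_sum (translate (- \<u> n) f))"
    unfolding quasi_integral_average[OF fm, symmetric] affine_sum_def
    by (intro sum_mono nn_integral_mono) (auto simp: indicator_def)
  also have "\<dots> \<le> (\<Sum>n<q ^ J. C * energy M (translate (- \<u> n) f))"
    by (intro sum_mono C L2_translate f)
  also have "\<dots> = of_nat (q ^ J) * (C * energy M f)"
    by (simp add: energy_translate[OF fm])
  finally show "(\<integral>\<^sup>+j. quasi_total j f * indicator {- int J..} j \<partial>count_space UNIV) \<le> C * energy M f"
    by (simp only: ennreal_mult_le_mult_iff[OF q_power_ennreal])
qed

lemma quasi_upper_imp_affine_upper:
  assumes C: "\<And>f. f \<in> L2 M \<Longrightarrow> quasi_sum f \<le> C * energy M f" and f: "f \<in> L2 M"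
  shows "affine_sum f \<le> C * energy M f"
  unfolding affine_sum_def
proof (rule nn_integral_int_le)
  fix J :: nat
  have fm: "f \<in> borel_measurable M" using f by (rule L2_measurable)
  have "(\<integral>\<^sup>+j. affine_total j f * indicator {- int J..} j \<partial>count_space UNIV)
      = (\<integral>\<^sup>+j. affine_total (j + - int J) f * indicator {- int J..} (j + - int J) \<partial>count_space UNIV)"
    by (rule nn_integral_int_shift[symmetric])
  also have "\<dots> \<le> quasi_sum (\<delta> (int J) f)"
    unfolding quasi_sum_def
  proof (rule nn_integral_mono)
    fix j
    show "affine_total (j + - int J) f * indicator {- int J..} (j + - int J) \<le> quasi_total j (\<delta> (int J) f)"
      by (cases "0 \<le> j") (simp_all add: quasi_total_nonneg affine_total_dilate[OF fm])
  qed
  also have "\<dots> \<le> C * energy M (\<delta> (int J) f)" by (intro C L2_dilate f)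
  also have "\<dots> = C * energy M f" by (simp add: energy_dilate[OF fm])
  finally show "(\<integral>\<^sup>+j. affine_total j f * indicator {- int J..} j \<partial>count_space UNIV) \<le> C * energy M f" .
qed

section \<open>Lower bounds\<close>

text \<open>Dilation by \<open>m\<close> turns level \<open>- m\<close> into level 0, where the
  shifts run over \<Lambda>. The dilated function vanishes off the displayed set, whose lattice
  overlap remains to be counted.\<close>

lemma affine_tail_level_le:
  assumes f: "f \<in> borel_measurable M" and g: "g \<in> borel_measurable M"
    and supp: "\<And>x. x \<notin> disc (int s) \<Longrightarrow> f x = 0"
  shows "affine_level (- int m) g (translate (- y) f)
    \<le> energy M f * (\<integral>\<^sup>+x. (\<Sum>k. indicator {z. v (inverse \<pi> ^ m * z + y) \<le> real q ^ s} (x + \<u> k))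
        * ennreal ((cmod (g x))\<^sup>2) \<partial>M)"
proof -
  let ?F = "\<delta> (int m) (translate (- y) f)"
  let ?E = "{z. v (inverse \<pi> ^ m * z + y) \<le> real q ^ s}"
  have tm: "translate (- y) f \<in> borel_measurable M" by (rule measurable_translate[OF f])
  have "affine_level (- int m) g (translate (- y) f) = affine_level 0 g ?F"
    by (simp add: affine_level_dilate[OF tm g])
  also have "\<dots> = (\<Sum>k. coeff M ?F (translate (\<u> k) g))" by (simp add: affine_level_def)
  also have "\<dots> \<le> energy M ?F * (\<integral>\<^sup>+x. (\<Sum>k. indicator ?E (x + \<u> k)) * ennreal ((cmod (g x))\<^sup>2) \<partial>M)"
  proof (rule lattice_coeff_le)
    have "?E = (\<lambda>z. inverse \<pi> ^ m * z + y) -` disc (int s)" by (auto simp: disc_def)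
    then show "?E \<in> sets borel" using measurable_sets_borel[OF measurable_affine disc_borel] by metis
    fix z assume "z \<notin> ?E"
    then have "f (inverse \<pi> ^ m * z + y) = 0" by (intro supp) (simp add: disc_def)
    then show "?F z = 0" by (simp add: dilate_def translate_def power_int_minus power_inverse)
  qed (intro measurable_dilate tm g)+
  also have "energy M ?F = energy M f" by (simp add: energy_dilate[OF tm] energy_translate[OF f])
  finally show ?thesis .
qed

text \<open>The overlap is summed over translates and levels pointwise in \<open>x\<close>, before
  the generator is integrated. The resulting bound does not depend on \<open>J\<close>, whereas the
  average runs over \<open>q ^ J\<close> translates.\<close>

lemma affine_tail_le:
  assumes f: "f \<in> borel_measurable M" and supp: "\<And>x. x \<notin> disc (int s) \<Longrightarrow> f x = 0" and J: "r + s \<le> J"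
  shows "(\<Sum>n\<in>{q ^ (J - r)..<q ^ J}. \<integral>\<^sup>+j. affine_total j (translate (- \<u> n) f) * indicator {..<- int J} j \<partial>count_space UNIV)
    \<le> of_nat (r * q ^ s) * (energy M f * (\<Sum>l\<in>{1..L}. energy M (\<psi> l)))"
proof -
  let ?N = "{q ^ (J - r)..<q ^ J}"
  define E where "E n m = {z. v (inverse \<pi> ^ (J + Suc m) * z + \<u> n) \<le> real q ^ s}" for n m
  have Eb: "E n m \<in> sets borel" for n m
  proof -
    have "E n m = (\<lambda>z. inverse \<pi> ^ (J + Suc m) * z + \<u> n) -` disc (int s)"
      by (auto simp: disc_def E_def simp del: power_Suc)
    then show ?thesis using measurable_sets_borel[OF measurable_affine disc_borel] by metis
  qed
  have level: "(\<Sum>n\<in>?N. \<Sum>m. affine_level (- int (J + Suc m)) g (translate (- \<u> n) f))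
      \<le> of_nat (r * q ^ s) * (energy M f * energy M g)" if g: "g \<in> borel_measurable M" for g
  proof -
    define T where "T n m x = (\<Sum>k. indicator (E n m) (x + \<u> k) :: ennreal) * ennreal ((cmod (g x))\<^sup>2)" for n m x
    have Tm: "T n m \<in> borel_measurable M" for n m
    proof -
      have "(\<lambda>x. indicator (E n m) (x + \<u> k) :: ennreal) \<in> borel_measurable M" for k
        unfolding measurable_M
        by (rule measurable_compose[OF measurable_plus_const]) (use Eb in simp)
      then show ?thesis unfolding T_def using g by measurable
    qed
    have "(\<Sum>n\<in>?N. \<Sum>m. affine_level (- int (J + Suc m)) g (translate (- \<u> n) f))
        \<le> (\<Sum>n\<in>?N. \<Sum>m. energy M f * (\<integral>\<^sup>+x. T n m x \<partial>M))"
      unfolding T_def E_def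
      by (intro sum_mono suminf_le affine_tail_level_le f g supp) auto
    also have "\<dots> = energy M f * (\<Sum>n\<in>?N. \<Sum>m. \<integral>\<^sup>+x. T n m x \<partial>M)"
      by (simp only: ennreal_suminf_cmult sum_distrib_left)
    also have "(\<Sum>n\<in>?N. \<Sum>m. \<integral>\<^sup>+x. T n m x \<partial>M) = (\<integral>\<^sup>+x. (\<Sum>n\<in>?N. \<Sum>m. T n m x) \<partial>M)"
      using Tm by (simp add: nn_integral_suminf[symmetric] nn_integral_sum)
    also have "\<dots> \<le> (\<integral>\<^sup>+x. of_nat (r * q ^ s) * ennreal ((cmod (g x))\<^sup>2) \<partial>M)"
    proof (rule nn_integral_mono)
      fix x
      have "(\<Sum>n\<in>?N. \<Sum>m. T n m x)
          = (\<Sum>n\<in>?N. \<Sum>m. \<Sum>k. indicator (E n m) (x + \<u> k)) * ennreal ((cmod (g x))\<^sup>2)"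
        by (simp only: T_def ennreal_suminf_multc sum_distrib_right)
      also have "\<dots> \<le> of_nat (r * q ^ s) * ennreal ((cmod (g x))\<^sup>2)"
        unfolding E_def by (intro mult_right_mono overlap_le J) auto
      finally show "(\<Sum>n\<in>?N. \<Sum>m. T n m x) \<le> of_nat (r * q ^ s) * ennreal ((cmod (g x))\<^sup>2)" .
    qed
    also have "\<dots> = of_nat (r * q ^ s) * energy M g"
      unfolding energy_def
    proof (rule nn_integral_cmult)
      show "(\<lambda>x. ennreal ((cmod (g x))\<^sup>2)) \<in> borel_measurable M"
        using g unfolding measurable_M by measurable
    qed
    finally show ?thesis by (simp add: mult_left_mono mult.left_commute)
  qed
  have "(\<Sum>n\<in>?N. \<integral>\<^sup>+j. affine_total j (translate (- \<u> n) f) * indicator {..<- int J} j \<partial>count_space UNIV)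
      = (\<Sum>n\<in>?N. \<Sum>m. \<Sum>l\<in>{1..L}. affine_level (- int (J + Suc m)) (\<psi> l) (translate (- \<u> n) f))"
    unfolding nn_integral_int_less affine_total_def ..
  also have "\<dots> = (\<Sum>n\<in>?N. \<Sum>l\<in>{1..L}. \<Sum>m. affine_level (- int (J + Suc m)) (\<psi> l) (translate (- \<u> n) f))"
    by (intro sum.cong refl suminf_sum) simp
  also have "\<dots> = (\<Sum>l\<in>{1..L}. \<Sum>n\<in>?N. \<Sum>m. affine_level (- int (J + Suc m)) (\<psi> l) (translate (- \<u> n) f))"
    by (rule sum.swap)
  also have "\<dots> \<le> (\<Sum>l\<in>{1..L}. of_nat (r * q ^ s) * (energy M f * energy M (\<psi> l)))"
    by (intro sum_mono level psi_measurable)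
  finally show ?thesis by (simp only: sum_distrib_left)
qed

lemma affine_lower_imp_quasi_lower_compact:
  assumes A: "\<And>f. f \<in> L2 M \<Longrightarrow> ennreal A * energy M f \<le> affine_sum f"
    and B: "\<And>f. f \<in> L2 M \<Longrightarrow> affine_sum f \<le> ennreal B * energy M f"
    and f: "f \<in> L2 M" and supp: "\<And>x. x \<notin> disc (int s) \<Longrightarrow> f x = 0"
  shows "ennreal A * energy M f \<le> quasi_sum f"
proof -
  have fm: "f \<in> borel_measurable M" using f by (rule L2_measurable)
  have fin: "energy M f < top" using f by (simp add: L2_iff)
  let ?P = "\<Sum>l\<in>{1..L}. energy M (\<psi> l)"
  have "?P < top" using psi_L2 by (auto simp: L2_iff)
  then have "ennreal B * energy M f + energy M f * ?P < top"
    using fin by (auto simp: ennreal_mult_less_top)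
  \<comment> \<open>The error constant must be finite and independent of \<open>k\<close>; square
    integrability of \<open>f\<close> and of the generators gives finiteness.\<close>
  then obtain d where d: "ennreal B * energy M f + energy M f * ?P = ennreal d"
    by (cases "ennreal B * energy M f + energy M f * ?P") auto
  show ?thesis
  proof (rule ennreal_le_of_power_scaled[OF q_ge_2])
    fix k
    \<comment> \<open>With \<open>r = k\<close> the exceptional translates are the first
      \<open>q ^ (k + s)\<close> out of \<open>q ^ J\<close>, a proportion \<open>q ^ (- k)\<close>.
      The summand \<open>s\<close> also absorbs the factor \<open>q ^ s\<close> of the overlap
      bound.\<close>
    define J where "J = k + (k + s)"
    let ?tail = "\<lambda>n. \<integral>\<^sup>+j. affine_total j (translate (- \<u> n) f) * indicator {..<- int J} j \<partial>count_space UNIV"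
    let ?Q = "q ^ (k + s)"
    have Jk: "J - k = k + s" by (simp add: J_def)
    have QJ: "?Q \<le> q ^ J" unfolding J_def using q_ge_2 by (intro power_increasing) auto
    have "of_nat (q ^ J) * (ennreal A * energy M f) = (\<Sum>n<q ^ J. ennreal A * energy M (translate (- \<u> n) f))"
      by (simp add: energy_translate[OF fm])
    also have "\<dots> \<le> (\<Sum>n<q ^ J. affine_sum (translate (- \<u> n) f))"
      by (intro sum_mono A L2_translate f)
    also have "\<dots> = (\<Sum>n<q ^ J. (\<integral>\<^sup>+j. affine_total j (translate (- \<u> n) f) * indicator {- int J..} j \<partial>count_space UNIV) + ?tail n)"
      unfolding affine_sum_def by (intro sum.cong refl nn_integral_int_split)
    also have "\<dots> = of_nat (q ^ J) * (\<integral>\<^sup>+j. quasi_total j f * indicator {- int J..} j \<partial>count_space UNIV) + (\<Sum>n<q ^ J. ?tail n)"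
      by (simp only: sum.distrib quasi_integral_average[OF fm])
    also have "\<dots> \<le> of_nat (q ^ J) * quasi_sum f + (\<Sum>n<q ^ J. ?tail n)"
      unfolding quasi_sum_def
      by (intro add_mono mult_left_mono nn_integral_mono order_refl) (auto simp: indicator_def)
    also have "(\<Sum>n<q ^ J. ?tail n) = (\<Sum>n<?Q. ?tail n) + (\<Sum>n\<in>{q ^ (J - k)..<q ^ J}. ?tail n)"
      unfolding Jk by (subst sum.union_disjoint[symmetric]) (use QJ in \<open>auto intro!: sum.cong\<close>)
    also have "\<dots> \<le> of_nat ?Q * (ennreal B * energy M f) + of_nat (k * q ^ s) * (energy M f * ?P)"
    proof (rule add_mono)
      have "(\<Sum>n<?Q. ?tail n) \<le> (\<Sum>n<?Q. affine_sum (translate (- \<u> n) f))"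
        unfolding affine_sum_def by (intro sum_mono nn_integral_mono) (auto simp: indicator_def)
      also have "\<dots> \<le> (\<Sum>n<?Q. ennreal B * energy M (translate (- \<u> n) f))"
        by (intro sum_mono B L2_translate f)
      finally show "(\<Sum>n<?Q. ?tail n) \<le> of_nat ?Q * (ennreal B * energy M f)"
        by (simp add: energy_translate[OF fm])
      show "(\<Sum>n\<in>{q ^ (J - k)..<q ^ J}. ?tail n) \<le> of_nat (k * q ^ s) * (energy M f * ?P)"
        by (rule affine_tail_le[OF fm supp]) (simp_all add: J_def)
    qed
    also have "\<dots> \<le> of_nat ?Q * (ennreal B * energy M f) + of_nat ?Q * (energy M f * ?P)"
    proof -
      \<comment> \<open>By \<open>k < q ^ k\<close> both errors are bounded by the same power of
        \<open>q\<close>; cancelling it against \<open>q ^ J\<close> leaves the factor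
        \<open>q ^ k\<close>.\<close>
      have "k * q ^ s \<le> ?Q" using less_q_power[of k] by (simp add: power_add)
      then show ?thesis by (intro add_mono mult_right_mono of_nat_mono order_refl) auto
    qed
    also have "\<dots> = of_nat ?Q * ennreal d" by (simp only: distrib_left[symmetric] d)
    finally have "of_nat (q ^ J) * (ennreal A * energy M f) \<le> of_nat (q ^ J) * quasi_sum f + of_nat ?Q * ennreal d"
      by (simp add: add_left_mono)
    moreover have "(of_nat (q ^ J) :: ennreal) = of_nat ?Q * of_nat (q ^ k)"
      by (simp only: of_nat_mult[symmetric] J_def power_add mult_ac)
    ultimately have "of_nat ?Q * (of_nat (q ^ k) * (ennreal A * energy M f))
        \<le> of_nat ?Q * (of_nat (q ^ k) * quasi_sum f + ennreal d)"
      by (simp only: mult.assoc distrib_left)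
    then show "of_nat (q ^ k) * (ennreal A * energy M f) \<le> of_nat (q ^ k) * quasi_sum f + ennreal d"
      by (simp only: ennreal_mult_le_mult_iff[OF q_power_ennreal])
  qed
qed

section \<open>Coarse levels of the quasi-affine system\<close>

lemma lattice_overlap_le_1: "(\<Sum>k. indicator (disc (- int i)) (x + \<u> k) :: ennreal) \<le> 1"
proof -
  let ?A = "{k. v (x + \<u> k) \<le> real q ^ 0}"
  have "(\<Sum>k. indicator (disc (- int i)) (x + \<u> k) :: ennreal) \<le> (\<Sum>k. indicator ?A k)"
  proof (intro suminf_le)
    fix k
    have "real q powi (- int i) \<le> 1"
      using q_real_gt_1 by (simp add: power_int_minus inverse_le_1_iff)
    then show "indicator (disc (- int i)) (x + \<u> k) \<le> (indicator ?A k :: ennreal)"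
      by (auto simp: indicator_def disc_def)
  qed auto
  also have "\<dots> \<le> of_nat 1"
    using card_lattice_disc[of x 0] by (intro suminf_indicator_le) auto
  finally show ?thesis by simp
qed

text \<open>At most one point of \<open>x + \<Lambda>\<close> lies in the unit disc, and since it is
  not 0 the shrinking discs lose it.\<close>

lemma lattice_overlap_eventually_0:
  assumes "\<And>k. x + \<u> k \<noteq> 0"
  shows "eventually (\<lambda>i. (\<Sum>k. indicator (disc (- int i)) (x + \<u> k) :: ennreal) = 0) sequentially"
proof -
  have small: "v (x + \<u> k) \<le> 1" if "x + \<u> k \<in> disc (- int i)" for i k
  proof -
    have "real q powi (- int i) \<le> 1"
      using q_real_gt_1 by (simp add: power_int_minus inverse_le_1_iff)
    then show ?thesis using that by (simp add: disc_def)
  qed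
  show ?thesis
  proof (cases "\<exists>k. v (x + \<u> k) \<le> 1")
    case True
    then obtain k0 where k0: "v (x + \<u> k0) \<le> 1" by blast
    have "v (x + \<u> k0) > 0" using assms by simp
    then obtain N where N: "(1 / real q) ^ N < v (x + \<u> k0)"
      using real_arch_pow_inv[of "v (x + \<u> k0)" "1 / real q"] q_real_gt_1 by auto
    have "(\<Sum>k. indicator (disc (- int i)) (x + \<u> k) :: ennreal) = 0" if "i \<ge> N" for i
    proof -
      have "x + \<u> k \<notin> disc (- int i)" for k
      proof
        assume k: "x + \<u> k \<in> disc (- int i)"
        then have "k = k0" using small lattice_unique k0 by blast
        then have "v (x + \<u> k0) \<le> (1 / real q) ^ i"
          using k by (simp add: disc_def power_int_minus power_one_over inverse_eq_divide)
        also have "\<dots> \<le> (1 / real q) ^ N" using that q_real_gt_1 by (intro power_decreasing) auto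
        finally show False using N by simp
      qed
      then show ?thesis by simp
    qed
    then show ?thesis unfolding eventually_sequentially by blast
  next
    case False
    then have "x + \<u> k \<notin> disc (- int i)" for k i using small by blast
    then show ?thesis by simp
  qed
qed

lemma AE_off_lattice: "AE x in M. \<forall>k. x + \<u> k \<noteq> 0"
proof (subst AE_all_countable, rule allI)
  fix k
  have "AE x in M. x \<noteq> - \<u> k"
    by (rule AE_I[of _ _ "{- \<u> k}"]) (auto simp: singleton_null)
  then show "AE x in M. x + \<u> k \<noteq> 0"
    by (rule AE_mp) (auto intro!: AE_I2 simp: eq_neg_iff_add_eq_0)
qed

text \<open>The weight is the quasi-affine factor at level \<open>- Suc m\<close>. As dilation
  preserves energy, it makes the sum over levels a geometric series, so one integrable function
  dominates all coarse levels together.\<close>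

definition tail_majorant :: "'a \<Rightarrow> ennreal" where
  "tail_majorant x = (\<Sum>l\<in>{1..L}. \<Sum>m. ennreal ((1 / real q) ^ Suc m) * ennreal ((cmod (\<delta> (- int (Suc m)) (\<psi> l) x))\<^sup>2))"

lemma dilate_psi_measurable:
  "l \<in> {1..L} \<Longrightarrow> (\<lambda>x. ennreal ((cmod (\<delta> j (\<psi> l) x))\<^sup>2)) \<in> borel_measurable M"
  using measurable_dilate[OF psi_measurable] unfolding measurable_M by measurable

lemma tail_majorant_measurable: "tail_majorant \<in> borel_measurable M"
  unfolding tail_majorant_def
  by (intro borel_measurable_sum borel_measurable_suminf_order borel_measurable_times_ennreal
      borel_measurable_const dilate_psi_measurable)

lemma tail_majorant_integral: "(\<integral>\<^sup>+x. tail_majorant x \<partial>M) < \<infinity>"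
proof -
  have g: "(\<Sum>m. ennreal ((1 / real q) ^ Suc m)) < top"
  proof -
    have "summable (\<lambda>m. (1 / real q) ^ Suc m)"
      using q_real_gt_1 by (subst summable_Suc_iff) (auto intro: summable_geometric)
    then have "(\<Sum>m. ennreal ((1 / real q) ^ Suc m)) \<noteq> top" by (intro ennreal_suminf_neq_top) auto
    then show ?thesis by (simp add: top.not_eq_extremum)
  qed
  have "(\<integral>\<^sup>+x. tail_majorant x \<partial>M)
      = (\<Sum>l\<in>{1..L}. \<Sum>m. ennreal ((1 / real q) ^ Suc m) * energy M (\<delta> (- int (Suc m)) (\<psi> l)))"
    unfolding tail_majorant_def energy_def using dilate_psi_measurable
    by (subst nn_integral_sum) (auto simp: nn_integral_suminf nn_integral_cmult intro!: sum.cong simp del: power_Suc)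
  also have "\<dots> = (\<Sum>l\<in>{1..L}. (\<Sum>m. ennreal ((1 / real q) ^ Suc m)) * energy M (\<psi> l))"
    by (intro sum.cong refl) (simp only: energy_dilate[OF psi_measurable] ennreal_suminf_multc)
  also have "\<dots> < \<infinity>"
    using psi_L2 g by (auto simp: L2_iff ennreal_mult_less_top simp del: power_Suc)
  finally show ?thesis .
qed

text \<open>At every level \<open>j < 0\<close> the shifts run over the same lattice \<Lambda>, so
  the overlap function does not depend on the level and factors out.\<close>

lemma quasi_tail_le:
  assumes F: "F \<in> borel_measurable M" and supp: "\<And>x. x \<notin> disc (- int i) \<Longrightarrow> F x = 0"
  shows "(\<integral>\<^sup>+j. quasi_total j F * indicator {..<0} j \<partial>count_space UNIV)
    \<le> energy M F * (\<integral>\<^sup>+x. (\<Sum>k. indicator (disc (- int i)) (x + \<u> k)) * tail_majorant x \<partial>M)"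
proof -
  define C where "C x = (\<Sum>k. indicator (disc (- int i)) (x + \<u> k) :: ennreal)" for x
  define T where "T l m x = ennreal ((cmod (\<delta> (- int (Suc m)) (\<psi> l) x))\<^sup>2)" for l m x
  have Cm: "C \<in> borel_measurable M"
  proof -
    have "(\<lambda>x. indicator (disc (- int i)) (x + \<u> k) :: ennreal) \<in> borel_measurable M" for k
      unfolding measurable_M by (rule measurable_compose[OF measurable_plus_const]) simp
    then show ?thesis unfolding C_def by (rule borel_measurable_suminf_order)
  qed
  have Tm: "T l m \<in> borel_measurable M" if "l \<in> {1..L}" for l m
    unfolding T_def by (rule dilate_psi_measurable[OF that])
  have level: "quasi_level (- int (Suc m)) (\<psi> l) F
      \<le> energy M F * (\<integral>\<^sup>+x. C x * (ennreal ((1 / real q) ^ Suc m) * T l m x) \<partial>M)" if l: "l \<in> {1..L}" for l m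
  proof -
    have "real q powi (- int (Suc m)) = (1 / real q) ^ Suc m"
      by (simp only: power_int_minus power_int_of_nat power_one_over inverse_eq_divide)
    then have "quasi_level (- int (Suc m)) (\<psi> l) F
        = ennreal ((1 / real q) ^ Suc m) * (\<Sum>k. coeff M F (translate (\<u> k) (\<delta> (- int (Suc m)) (\<psi> l))))"
      by (simp add: quasi_level_def del: power_Suc)
    also have "\<dots> \<le> ennreal ((1 / real q) ^ Suc m) * (energy M F * (\<integral>\<^sup>+x. C x * T l m x \<partial>M))"
      unfolding C_def T_def
      by (intro mult_left_mono lattice_coeff_le F measurable_dilate psi_measurable l disc_borel supp) auto
    also have "\<dots> = energy M F * (\<integral>\<^sup>+x. ennreal ((1 / real q) ^ Suc m) * (C x * T l m x) \<partial>M)"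
      using Cm Tm[OF l] by (subst nn_integral_cmult) (auto simp: mult.left_commute simp del: power_Suc)
    finally show ?thesis by (simp only: mult.left_commute)
  qed
  have "(\<integral>\<^sup>+j. quasi_total j F * indicator {..<0} j \<partial>count_space UNIV) = (\<Sum>m. quasi_total (- int (Suc m)) F)"
    using nn_integral_int_less[of "\<lambda>j. quasi_total j F" 0] by simp
  also have "\<dots> \<le> (\<Sum>m. \<Sum>l\<in>{1..L}. energy M F * (\<integral>\<^sup>+x. C x * (ennreal ((1 / real q) ^ Suc m) * T l m x) \<partial>M))"
    unfolding quasi_total_def by (intro suminf_le sum_mono level) auto
  also have "\<dots> = (\<Sum>l\<in>{1..L}. \<Sum>m. energy M F * (\<integral>\<^sup>+x. C x * (ennreal ((1 / real q) ^ Suc m) * T l m x) \<partial>M))"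
    by (rule suminf_sum) simp
  also have "\<dots> = energy M F * (\<Sum>l\<in>{1..L}. \<Sum>m. (\<integral>\<^sup>+x. C x * (ennreal ((1 / real q) ^ Suc m) * T l m x) \<partial>M))"
    by (simp only: ennreal_suminf_cmult sum_distrib_left)
  also have "(\<Sum>l\<in>{1..L}. \<Sum>m. (\<integral>\<^sup>+x. C x * (ennreal ((1 / real q) ^ Suc m) * T l m x) \<partial>M))
      = (\<Sum>l\<in>{1..L}. \<integral>\<^sup>+x. (\<Sum>m. C x * (ennreal ((1 / real q) ^ Suc m) * T l m x)) \<partial>M)"
    using Cm Tm by (intro sum.cong refl nn_integral_suminf[symmetric]) auto
  also have "\<dots> = (\<integral>\<^sup>+x. (\<Sum>l\<in>{1..L}. \<Sum>m. C x * (ennreal ((1 / real q) ^ Suc m) * T l m x)) \<partial>M)"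
    using Cm Tm by (intro nn_integral_sum[symmetric]) auto
  also have "\<dots> = (\<integral>\<^sup>+x. C x * tail_majorant x \<partial>M)"
    by (simp only: tail_majorant_def T_def ennreal_suminf_cmult sum_distrib_left)
  finally show ?thesis by (simp only: C_def)
qed

lemma tail_integral_tendsto:
  "(\<lambda>i. \<integral>\<^sup>+x. (\<Sum>k. indicator (disc (- int i)) (x + \<u> k)) * tail_majorant x \<partial>M) \<longlonglongrightarrow> 0"
proof -
  let ?C = "\<lambda>i x. (\<Sum>k. indicator (disc (- int i)) (x + \<u> k) :: ennreal)"
  have Cm: "?C i \<in> borel_measurable M" for i
  proof -
    have "(\<lambda>x. indicator (disc (- int i)) (x + \<u> k) :: ennreal) \<in> borel_measurable M" for k
      unfolding measurable_M by (rule measurable_compose[OF measurable_plus_const]) simp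
    then show ?thesis by (rule borel_measurable_suminf_order)
  qed
  have "(\<lambda>i. \<integral>\<^sup>+x. ?C i x * tail_majorant x \<partial>M) \<longlonglongrightarrow> (\<integral>\<^sup>+x. 0 \<partial>M)"
  proof (rule nn_integral_dominated_convergence[where w = tail_majorant])
    show "(\<lambda>x. ?C i x * tail_majorant x) \<in> borel_measurable M" for i
      by (intro borel_measurable_times_ennreal Cm tail_majorant_measurable)
    show "AE x in M. ?C i x * tail_majorant x \<le> tail_majorant x" for i
      using mult_right_mono[OF lattice_overlap_le_1] by (intro AE_I2) fastforce
    show "AE x in M. (\<lambda>i. ?C i x * tail_majorant x) \<longlonglongrightarrow> 0"
      using AE_off_lattice
    proof (rule AE_mp, intro AE_I2 impI)
      fix x assume "\<forall>k. x + \<u> k \<noteq> 0"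
      then have "eventually (\<lambda>i. ?C i x = 0) sequentially" by (intro lattice_overlap_eventually_0) blast
      then have "eventually (\<lambda>i. ?C i x * tail_majorant x = 0) sequentially" by (rule eventually_mono) simp
      then show "(\<lambda>i. ?C i x * tail_majorant x) \<longlonglongrightarrow> 0" by (rule tendsto_eventually)
    qed
  qed (use tail_majorant_measurable tail_majorant_integral in auto)
  then show ?thesis by simp
qed

lemma quasi_lower_imp_affine_lower_compact:
  assumes A: "\<And>f. f \<in> L2 M \<Longrightarrow> ennreal A * energy M f \<le> quasi_sum f"
    and f: "f \<in> L2 M" and supp: "\<And>x. x \<notin> disc (int s) \<Longrightarrow> f x = 0"
  shows "ennreal A * energy M f \<le> affine_sum f"
proof -
  have fm: "f \<in> borel_measurable M" using f by (rule L2_measurable)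
  let ?t = "\<lambda>i. \<integral>\<^sup>+x. (\<Sum>k. indicator (disc (- int i)) (x + \<u> k)) * tail_majorant x \<partial>M"
  have le: "ennreal A * energy M f \<le> affine_sum f + energy M f * ?t i" for i
  proof -
    \<comment> \<open>Dilation by \<open>s + i\<close> shrinks the support from
      \<open>disc s\<close> into \<open>disc (- i)\<close> and changes neither the energy nor the
      affine sum.\<close>
    define F where "F = \<delta> (int (s + i)) f"
    have F: "F \<in> L2 M" unfolding F_def by (rule L2_dilate[OF f])
    have F0: "F x = 0" if "x \<notin> disc (- int i)" for x
    proof -
      have "real q powi (- int i) < v x" using that by (simp add: disc_def)
      then have "real q ^ (s + i) * real q powi (- int i) < real q ^ (s + i) * v x"
        using q_real_pos by (intro mult_strict_left_mono) auto
      also have "real q ^ (s + i) * real q powi (- int i) = real q ^ s"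
        using q_real_pos by (simp add: power_add power_int_minus)
      finally have "\<pi> powi (- int (s + i)) * x \<notin> disc (int s)"
        by (simp add: disc_def v_mult v_pi_powi del: of_nat_add)
      then show ?thesis unfolding F_def dilate_def using supp by simp
    qed
    have "ennreal A * energy M f = ennreal A * energy M F" by (simp add: F_def energy_dilate[OF fm])
    also have "\<dots> \<le> quasi_sum F" by (rule A[OF F])
    also have "\<dots> = (\<integral>\<^sup>+j. quasi_total j F * indicator {0..} j \<partial>count_space UNIV)
        + (\<integral>\<^sup>+j. quasi_total j F * indicator {..<0} j \<partial>count_space UNIV)"
      unfolding quasi_sum_def by (rule nn_integral_int_split)
    also have "\<dots> \<le> affine_sum F + energy M F * ?t i"
    proof (rule add_mono)
      show "(\<integral>\<^sup>+j. quasi_total j F * indicator {0..} j \<partial>count_space UNIV) \<le> affine_sum F"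
        unfolding affine_sum_def
        by (intro nn_integral_mono) (auto simp: indicator_def quasi_total_nonneg)
      show "(\<integral>\<^sup>+j. quasi_total j F * indicator {..<0} j \<partial>count_space UNIV) \<le> energy M F * ?t i"
        by (rule quasi_tail_le[OF L2_measurable[OF F] F0])
    qed
    also have "\<dots> = affine_sum f + energy M f * ?t i"
      by (simp add: F_def energy_dilate[OF fm] affine_sum_dilate[OF fm])
    finally show ?thesis .
  qed
  have "(\<lambda>i. affine_sum f + energy M f * ?t i) \<longlonglongrightarrow> affine_sum f + energy M f * 0"
    using f by (intro tendsto_add tendsto_const ennreal_tendsto_cmult tail_integral_tendsto) (simp add: L2_iff)
  then show ?thesis using le LIMSEQ_le_const by fastforce
qed

section \<open>Truncation to discs\<close>

definition truncate :: "nat \<Rightarrow> ('a \<Rightarrow> complex) \<Rightarrow> 'a \<Rightarrow> complex" where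
  "truncate s f x = indicator (disc (int s)) x * f x"

lemma eventually_disc: "eventually (\<lambda>s. x \<in> disc (int s)) sequentially"
proof -
  obtain N where N: "v x < real q ^ N" using real_arch_pow[OF q_real_gt_1] by blast
  have "x \<in> disc (int s)" if "s \<ge> N" for s
  proof -
    have "real q ^ N \<le> real q ^ s" using that q_real_gt_1 by (intro power_increasing) auto
    then show ?thesis using N by (simp add: disc_def)
  qed
  then show ?thesis unfolding eventually_sequentially by blast
qed

lemma truncate_L2: assumes f: "f \<in> L2 M" shows "truncate s f \<in> L2 M"
proof -
  have m: "truncate s f \<in> borel_measurable M"
    using L2_measurable[OF f] unfolding truncate_def measurable_M by measurable
  have "energy M (truncate s f) \<le> energy M f"
    unfolding energy_def truncate_def by (intro nn_integral_mono) (auto simp: indicator_def)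
  then show ?thesis using f m by (auto simp: L2_iff)
qed

lemma truncate_error_tendsto:
  assumes f: "f \<in> L2 M"
  shows "(\<lambda>s. energy M (\<lambda>x. f x - truncate s f x)) \<longlonglongrightarrow> 0"
proof -
  have fm: "(\<lambda>x. ennreal ((cmod (f x))\<^sup>2)) \<in> borel_measurable M"
    using L2_measurable[OF f] unfolding measurable_M by measurable
  have "(\<lambda>s. \<integral>\<^sup>+x. ennreal ((cmod (f x - truncate s f x))\<^sup>2) \<partial>M) \<longlonglongrightarrow> (\<integral>\<^sup>+x. 0 \<partial>M)"
  proof (rule nn_integral_dominated_convergence[where w = "\<lambda>x. ennreal ((cmod (f x))\<^sup>2)"])
    show "(\<lambda>x. ennreal ((cmod (f x - truncate s f x))\<^sup>2)) \<in> borel_measurable M" for s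
      using L2_measurable[OF L2_diff[OF f truncate_L2[OF f]]] unfolding measurable_M by measurable
    show "AE x in M. (\<lambda>s. ennreal ((cmod (f x - truncate s f x))\<^sup>2)) \<longlonglongrightarrow> 0"
    proof (rule AE_I2)
      fix x
      have "eventually (\<lambda>s. ennreal ((cmod (f x - truncate s f x))\<^sup>2) = 0) sequentially"
        using eventually_disc[of x] by (rule eventually_mono) (simp add: truncate_def)
      then show "(\<lambda>s. ennreal ((cmod (f x - truncate s f x))\<^sup>2)) \<longlonglongrightarrow> 0" by (rule tendsto_eventually)
    qed
    show "AE x in M. ennreal ((cmod (f x - truncate s f x))\<^sup>2) \<le> ennreal ((cmod (f x))\<^sup>2)" for s
      by (intro AE_I2) (auto simp: truncate_def indicator_def)
  qed (use f fm in \<open>auto simp: L2_iff energy_def\<close>)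
  then show ?thesis by (simp add: energy_def)
qed

lemma energy_truncate_split:
  assumes f: "f \<in> L2 M"
  shows "energy M f = energy M (truncate s f) + energy M (\<lambda>x. f x - truncate s f x)"
proof -
  have "energy M f = (\<integral>\<^sup>+x. ennreal ((cmod (truncate s f x))\<^sup>2) + ennreal ((cmod (f x - truncate s f x))\<^sup>2) \<partial>M)"
    unfolding energy_def by (intro nn_integral_cong) (auto simp: truncate_def indicator_def)
  also have "\<dots> = energy M (truncate s f) + energy M (\<lambda>x. f x - truncate s f x)"
    unfolding energy_def
  proof (rule nn_integral_add)
    show "(\<lambda>x. ennreal ((cmod (truncate s f x))\<^sup>2)) \<in> borel_measurable M"
      using L2_measurable[OF truncate_L2[OF f]] unfolding measurable_M by measurable
    show "(\<lambda>x. ennreal ((cmod (f x - truncate s f x))\<^sup>2)) \<in> borel_measurable M"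
      using L2_measurable[OF L2_diff[OF f truncate_L2[OF f]]] unfolding measurable_M by measurable
  qed
  finally show ?thesis .
qed

text \<open>Two limits in a fixed order: for fixed \<open>t\<close> the discs grow until the
  truncation error vanishes, then \<open>t\<close> tends to 0. The upper bound makes the
  coefficients of the removed part small together with its energy.\<close>

lemma lower_bound_from_compact:
  assumes e: "\<And>i. i \<in> I \<Longrightarrow> e i \<in> L2 M" and I: "countable I"
    and B: "\<And>f. f \<in> L2 M \<Longrightarrow> coeff_sum M I e f \<le> ennreal B * energy M f"
    and A: "\<And>f s. f \<in> L2 M \<Longrightarrow> (\<And>x. x \<notin> disc (int s) \<Longrightarrow> f x = 0) \<Longrightarrow> ennreal A * energy M f \<le> coeff_sum M I e f"
    and f: "f \<in> L2 M"
  shows "ennreal A * energy M f \<le> coeff_sum M I e f"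
proof -
  let ?S = "coeff_sum M I e"
  have conv: "?S f = (\<integral>\<^sup>+i. coeff M f (e i) \<partial>count_space I)" for f
    unfolding coeff_sum_def coeff_def by (rule infsum_ennreal_conv_nn_integral[OF I])
  have fin: "energy M f < top" using f by (simp add: L2_iff)
  have Sfin: "?S f < top" using B[OF f] fin by (auto simp: ennreal_mult_less_top intro: le_less_trans)
  have step: "ennreal A * energy M f \<le> ennreal (1 + t) * ?S f" if t: "t > 0" for t
  proof -
    \<comment> \<open>The first summand accounts for the coefficients of the removed part, the
      second for its energy, which truncation takes from the left side.\<close>
    let ?C = "ennreal (1 + 1 / t) * ennreal B + ennreal A"
    have le: "ennreal A * energy M f \<le> ennreal (1 + t) * ?S f + ?C * energy M (\<lambda>x. f x - truncate s f x)" for s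
    proof -
      let ?g = "truncate s f" and ?h = "\<lambda>x. f x - truncate s f x"
      have g: "?g \<in> L2 M" by (rule truncate_L2[OF f])
      have h: "?h \<in> L2 M" by (rule L2_diff[OF f g])
      have "ennreal A * energy M ?g \<le> ?S ?g" by (rule A[OF g, of s]) (simp add: truncate_def)
      also have "\<dots> \<le> (\<integral>\<^sup>+i. ennreal (1 + t) * coeff M f (e i) + ennreal (1 + 1 / t) * coeff M ?h (e i) \<partial>count_space I)"
        unfolding conv using e by (intro nn_integral_mono coeff_diff_le f g t) auto
      also have "\<dots> = ennreal (1 + t) * ?S f + ennreal (1 + 1 / t) * ?S ?h"
        unfolding conv by (simp add: nn_integral_add nn_integral_cmult)
      also have "\<dots> \<le> ennreal (1 + t) * ?S f + ennreal (1 + 1 / t) * (ennreal B * energy M ?h)"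
        by (intro add_left_mono mult_left_mono B h) auto
      finally have "ennreal A * energy M ?g + ennreal A * energy M ?h
          \<le> ennreal (1 + t) * ?S f + ennreal (1 + 1 / t) * (ennreal B * energy M ?h) + ennreal A * energy M ?h"
        by (rule add_right_mono)
      then show ?thesis
        by (subst energy_truncate_split[OF f, of s]) (simp only: distrib_left distrib_right mult.assoc add.assoc)
    qed
    have "(\<lambda>s. ennreal (1 + t) * ?S f + ?C * energy M (\<lambda>x. f x - truncate s f x)) \<longlonglongrightarrow> ennreal (1 + t) * ?S f + ?C * 0"
      by (intro tendsto_add tendsto_const ennreal_tendsto_cmult truncate_error_tendsto f)
        (auto simp: ennreal_mult_less_top)
    then show ?thesis using le LIMSEQ_le_const by fastforce
  qed
  obtain \<sigma> where \<sigma>: "?S f = ennreal \<sigma>" "\<sigma> \<ge> 0" using Sfin by (cases "?S f") auto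
  show ?thesis
  proof (rule ennreal_le_epsilon)
    fix d :: real assume d: "d > 0"
    \<comment> \<open>Chosen for \<open>t * \<sigma> \<le> d\<close>; the summand 1 covers
      \<open>\<sigma> = 0\<close>.\<close>
    define t where "t = d / (\<sigma> + 1)"
    have t: "t > 0" using d \<sigma> by (simp add: t_def)
    have "t * \<sigma> \<le> d" using d \<sigma> by (simp add: t_def field_simps)
    have "ennreal A * energy M f \<le> ennreal (1 + t) * ?S f" by (rule step[OF t])
    also have "\<dots> = ennreal ((1 + t) * \<sigma>)" using t \<sigma> by (simp add: ennreal_mult)
    also have "\<dots> \<le> ennreal (\<sigma> + d)" using \<open>t * \<sigma> \<le> d\<close> by (intro ennreal_leI) (simp add: algebra_simps)
    also have "\<dots> = ?S f + ennreal d" using d \<sigma> by simp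
    finally show "ennreal A * energy M f \<le> ?S f + ennreal d" .
  qed
qed

section \<open>Transfer of Bessel and frame bounds\<close>

abbreviation "X \<equiv> affine_system p c \<pi> \<epsilon> \<psi>"
abbreviation "Y \<equiv> quasi_affine_system p c \<pi> \<epsilon> \<psi>"

lemma X_L2: "i \<in> index \<Longrightarrow> X i \<in> L2 M"
  by (auto simp: affine_system_def q_def[symmetric] intro!: L2_dilate L2_translate psi_L2)

lemma L2_scale: assumes "h \<in> L2 M" shows "(\<lambda>x. of_real r * h x) \<in> L2 M"
proof -
  have "integrable M (\<lambda>x. r\<^sup>2 * (cmod (h x))\<^sup>2)" using assms by (simp add: L2_def)
  then have "integrable M (\<lambda>x. (cmod (of_real r * h x))\<^sup>2)" by (simp add: norm_mult power_mult_distrib)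
  moreover have "(\<lambda>x. of_real r * h x) \<in> borel_measurable M"
    using L2_measurable[OF assms] by measurable
  ultimately show ?thesis by (simp add: L2_def)
qed

lemma Y_L2: "i \<in> index \<Longrightarrow> Y i \<in> L2 M"
  by (auto simp: quasi_affine_system_def q_def[symmetric] intro!: L2_scale L2_dilate L2_translate psi_L2)

lemma upper_bound_affine_iff_quasi: "upper_bound M index X B \<longleftrightarrow> upper_bound M index Y B"
  unfolding upper_bound_iff coeff_sum_affine coeff_sum_quasi
  using affine_upper_imp_quasi_upper quasi_upper_imp_affine_upper by blast

text \<open>Upper bounds agree, so \<open>B\<close> serves both systems. The equivalence holds for
  every \<open>A\<close>, which makes the sets of lower bounds, and hence their suprema,
  equal.\<close>

lemma lower_bound_affine_iff_quasi:
  assumes B: "upper_bound M index X B"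
  shows "lower_bound M index X A \<longleftrightarrow> lower_bound M index Y A"
proof
  have BX: "affine_sum f \<le> ennreal B * energy M f" if "f \<in> L2 M" for f
    using B that unfolding upper_bound_iff coeff_sum_affine by blast
  have BY: "quasi_sum f \<le> ennreal B * energy M f" if "f \<in> L2 M" for f
    using affine_upper_imp_quasi_upper BX that by blast
  have I: "countable index" by (intro countable_SIGMA) auto
  {
    assume "lower_bound M index X A"
    then have A: "ennreal A * energy M f \<le> affine_sum f" if "f \<in> L2 M" for f
      using that unfolding lower_bound_iff coeff_sum_affine by blast
    show "lower_bound M index Y A"
      unfolding lower_bound_iff
    proof
      fix f assume f: "f \<in> L2 M"
      show "ennreal A * energy M f \<le> coeff_sum M index Y f"
      proof (rule lower_bound_from_compact[where B = B, OF Y_L2 I _ _ f])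
        fix f s assume f: "f \<in> L2 M" and supp: "\<And>x. x \<notin> disc (int s) \<Longrightarrow> f x = 0"
        show "ennreal A * energy M f \<le> coeff_sum M index Y f"
          unfolding coeff_sum_quasi 
          by (rule affine_lower_imp_quasi_lower_compact[where B = B and s = s])
            (erule A, erule BX, rule f, erule supp)
      qed (assumption, unfold coeff_sum_quasi, erule BY)
    qed
  }
  {
    assume "lower_bound M index Y A"
    then have A: "ennreal A * energy M f \<le> quasi_sum f" if "f \<in> L2 M" for f
      using that unfolding lower_bound_iff coeff_sum_quasi by blast
    show "lower_bound M index X A"
      unfolding lower_bound_iff
    proof
      fix f assume f: "f \<in> L2 M"
      show "ennreal A * energy M f \<le> coeff_sum M index X f"
      proof (rule lower_bound_from_compact[where B = B, OF X_L2 I _ _ f])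
        fix f s assume f: "f \<in> L2 M" and supp: "\<And>x. x \<notin> disc (int s) \<Longrightarrow> f x = 0"
        show "ennreal A * energy M f \<le> coeff_sum M index X f"
          unfolding coeff_sum_affine 
          by (rule quasi_lower_imp_affine_lower_compact[where s = s]) (erule A, rule f, erule supp)
      qed (assumption, unfold coeff_sum_affine, erule BX)
    qed
  }
qed

lemma exact_upper_bound_affine_eq_quasi: "exact_upper_bound M index X = exact_upper_bound M index Y"
  by (simp only: exact_upper_bound_def upper_bound_affine_iff_quasi)

lemma bessel_affine_iff_quasi: "bessel_family M index X \<longleftrightarrow> bessel_family M index Y"
  by (simp only: bessel_family_def upper_bound_affine_iff_quasi)

lemma frame_affine_iff_quasi: "frame M index X \<longleftrightarrow> frame M index Y"
  unfolding frame_def using upper_bound_affine_iff_quasi lower_bound_affine_iff_quasi by blast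

lemma exact_lower_bound_affine_eq_quasi:
  assumes "frame M index X" shows "exact_lower_bound M index X = exact_lower_bound M index Y"
proof -
  obtain B where "upper_bound M index X B" using assms by (auto simp: frame_def)
  then show ?thesis by (simp only: exact_lower_bound_def lower_bound_affine_iff_quasi)
qed

end

theorem theorem3p1:
  fixes M :: "'k::local_field measure"
    and v :: "'k \<Rightarrow> real"
    and p c L :: nat
    and \<pi> :: 'k
    and \<epsilon> :: "nat \<Rightarrow> 'k"
    and \<psi> :: "nat \<Rightarrow> 'k \<Rightarrow> complex"
  defines "I \<equiv> {1..L} \<times> (UNIV :: int set) \<times> (UNIV :: nat set)"
    and "X \<equiv> affine_system p c \<pi> \<epsilon> \<psi>"
    and "Y \<equiv> quasi_affine_system p c \<pi> \<epsilon> \<psi>"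
  assumes "CHAR('k) = p" and "p > 0"
    and "additive_haar_measure M"
    and "modulus_of M v"
    and "emeasure M (integer_ring v) = 1"
    and "prime_element v \<pi>"
    and "card (residue_classes v) = p ^ c" and "c \<ge> 1"
    and "residue_basis v p c \<epsilon>"
    and "\<And>l. l \<in> {1..L} \<Longrightarrow> \<psi> l \<in> L2 M"
  shows "(bessel_family M I X \<longleftrightarrow> bessel_family M I Y) \<and>
         (bessel_family M I X \<longrightarrow> exact_upper_bound M I X = exact_upper_bound M I Y) \<and>
         (frame M I X \<longleftrightarrow> frame M I Y) \<and>
         (frame M I X \<longrightarrow> exact_lower_bound M I X = exact_lower_bound M I Y \<and>
                             exact_upper_bound M I X = exact_upper_bound M I Y)"
proof -
  interpret wavelet_family M v p c \<pi> \<epsilon> L \<psi>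
    by unfold_locales (use assms in auto)
  show ?thesis
    unfolding I_def X_def Y_def
    using bessel_affine_iff_quasi exact_upper_bound_affine_eq_quasi frame_affine_iff_quasi
      exact_lower_bound_affine_eq_quasi by blast
qed

end
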